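(* Consider the ARMA system with binary-valued observations, the standing assumptions, the identification algorithm with step size $\gamma$, and the constants $h$, $g(h)$, $M$, $h_1$, $f_M$, $f_m$, $M_1$, $M_2$, $\delta$ described in the context. Suppose $$f_{m}\delta-\frac{f_{M}\sqrt{g(h)}\,M_{2}M}{1-h_1}\,(M_{2}+2M_{1})>0$$ and that the step size satisfies $$\gamma>\frac{1}{2\left(f_{m}\delta-\dfrac{f_{M}\sqrt{g(h)}\,M_{2}M}{1-h_1}\,(M_{2}+2M_{1})\right)}.$$ Then, with $e_k=\hat\theta_k-\theta$, the mean square estimation error satisfies $$E\{e_k^Te_k\}=O\left(\frac1k\right)\quad\text{as }k\to\infty.$$
   Context: **System.** Let $p,q\ge 1$ be integers, $z$ the delay (backward shift) operator, $A(z)=a_1+a_2z+\cdots+a_pz^{p-1}$ with $a_p\ne0$, $B(z)=b_1+b_2z+\cdots+b_qz^{q-1}$ (real coefficients), where $1-zA(z)$ and $B(z)$ have no common roots. The system is, for $k\ge1$, $$y_k=A(z)y_{k-1}+B(z)u_k=\sum_{i=1}^p a_iy_{k-i}+\sum_{j=1}^q b_ju_{k-j+1},\qquad z_k=y_k+d_k,\qquad s_k=I_{\{z_k\le C\}},$$ where $u_k\in\mathbb R$ is the input, $d_k\in\mathbb R$ is the noise, $C\in\mathbb R$ is a fixed threshold, and $s_k$ is the binary observation ($s_k=1$ if $z_k\le C$ and $s_k=0$ otherwise). Values at nonpositive times are fixed initial values. Put $\theta=[a_1,\dots,a_p,b_1,\dots,b_q]^T$ (the unknown true parameter) and $\phi_k=[y_{k-1},\dots,y_{k-p},u_k,\dots,u_{k-q+1}]^T$,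 so $y_k=\phi_k^T\theta$. **Standing assumptions.** 1. A number $h\in(0,1)$ is given, and all roots of $1-a_1z-\cdots-a_pz^p=0$ have modulus greater than $1/h$ (in particular they lie outside the unit circle). 2. Let $\Omega\subset\mathbb R^{p+q}$ be the set of parameter vectors satisfying Assumption 1. The true parameter $\theta$ belongs to a known convex compact set $\Theta\subseteq\Omega$. Put $B=\sup_{v\in\Theta}\|v\|$. 3. $\{d_k\}_{k\ge1}$ is i.i.d. with $E\{d_k\}=0$ and known distribution function $F$, whose density $f(x)=dF(x)/dx$ is continuous and $f(x)\ne0$ for all $x$. 4. The input sequence $\{u_k\}$ is bounded, and there exist a constant $\delta_1>0$ and an integer $m>0$ such that $\frac1m\sum_{i=k}^{k+m-1}U_iU_i^T\ge\delta_1I_{p+q}$ for $k=1,2,\dots$ (in the positive semidefinite order), where $U_i=[u_i,u_{i-1},\dots,u_{i-p-q+1}]^T$ and $I_{p+q}$ is the identity matrix. **Algorithm.** Let $\Pi_\Theta(x)=\arg\min_{\lambda\in\Theta}\|x-\lambda\|$ denote the Euclidean projection onto $\Theta$. With step size $\gamma>0$ and given initial values, for $k\ge1$: $$\hat\theta_k=\Pi_\Theta\Big\{\hat\theta_{k-1}+\frac{\gamma}{k}\varphi_k\big(F(C-\varphi_k^T\hat\theta_{k-1})-s_k\big)\Big\},$$ $$\varphi_k=[\hat y_{k-1},\dots,\hat y_{k-p},u_k,\dots,u_{k-q+1}]^T,\qquad \hat y_{k-1}=\varphi_{k-1}^T\hat\theta_{k-1}.$$ **Constants.** $\|\cdot\|$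 is the Euclidean norm (for matrices, the induced norm). - $g(h)=p^2h^2+\big(\tfrac{p(p-1)}{2}h^2\big)^2+\cdots+h^{2p}=\sum_{i=1}^p\binom{p}{i}^2h^{2i}$, an upper bound for $\sum_{i=1}^pa_i^2$. - Let $A$ be the $p\times p$ companion matrix with first row $(a_1,\dots,a_p)$, ones on the subdiagonal and zeros elsewhere, and let $\rho(A)$ be its spectral radius. Fix $\epsilon>0$ such that $h_1:=\rho(A)+\epsilon\|A\|<1$, and put $M:=\sqrt p\,(1+2/\epsilon)^{p-1}$; then $\|A^k\|\le Mh_1^k$ for all $k\ge0$. - $M_1,M_2>0$ are constants with $\|\phi_k\|\le M_1$ and $\|\varphi_k\|\le M_2$ for all $k$. - $f_M$ and $f_m$ are the maximum and the minimum of $f$ on $[C-BM_2,C+BM_2]\cup[C-BM_1,C+BM_1]$. - $\delta=c_0\delta_1/N$ with $N=p+m$, where $c_0>0$ is a constant such that $\lambda_{\min}\big(\sum_{i=k}^{k+p+m-1}\phi_i\phi_i^T\big)\ge c_0\,\lambda_{\min}\big(\frac1m\sum_{i=k+p}^{k+p+m-1}U_iU_i^T\big)$ for all $k>0$; consequently $\frac1N\sum_{i=k}^{k+N-1}\phi_i\phi_i^T\ge\delta I_{p+q}$ for all $k>0$. *)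

theory Defs
  imports "HOL-Probability.Probability" "HOL-Computational_Algebra.Polynomial"
    "HOL-Library.Landau_Symbols"
begin

text \<open>
  Dimensions are finite linearly ordered index types. \<open>coord i\<close> is the 1-based position of the
  index \<open>i\<close>, so that \<open>x $ i\<close> is the entry of \<open>x\<close> written with subscript \<open>coord i\<close> on paper.
  A vector in \<open>real ^ ('p + 'q)\<close> is a column of length \<open>p + q\<close>: first the \<open>Inl\<close> block of length
  \<open>p = CARD('p)\<close>, then the \<open>Inr\<close> block of length \<open>q = CARD('q)\<close>.
\<close>

definition coord :: "'n::{finite,linorder} \<Rightarrow> nat" where
  "coord i = card {..i}"

lemma coord_strict_mono: "strict_mono (coord :: 'n::{finite,linorder} \<Rightarrow> nat)"
  unfolding strict_mono_def coord_def by (auto intro!: psubset_card_mono)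

lemma bij_betw_coord: "bij_betw (coord :: 'n::{finite,linorder} \<Rightarrow> nat) UNIV {1..CARD('n)}"
proof -
  have inj: "inj (coord :: 'n \<Rightarrow> nat)"
    by (rule strict_mono_imp_inj_on[OF coord_strict_mono])
  have "coord i \<ge> 1" for i :: 'n
    unfolding coord_def by (simp add: Suc_le_eq card_gt_0_iff)
  moreover have "coord i \<le> CARD('n)" for i :: 'n
    unfolding coord_def by (rule card_mono) auto
  ultimately have "range (coord :: 'n \<Rightarrow> nat) \<subseteq> {1..CARD('n)}" by auto
  moreover have "card (range (coord :: 'n \<Rightarrow> nat)) = card {1..CARD('n)}"
    using card_image[OF inj] by simp
  ultimately have "range (coord :: 'n \<Rightarrow> nat) = {1..CARD('n)}"
    by (intro card_subset_eq) auto
  with inj show ?thesis by (simp add: bij_betw_def)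
qed

definition ar_part :: "real ^ ('p::finite + 'q::finite) \<Rightarrow> real ^ 'p" where
  "ar_part v = (\<chi> i. v $ Inl i)"

definition input_part :: "real ^ ('p::finite + 'q::finite) \<Rightarrow> real ^ 'q" where
  "input_part v = (\<chi> j. v $ Inr j)"

text \<open>\<open>coeff_poly c\<close> is \<open>c\<^sub>1 + c\<^sub>2 z + \<dots> + c\<^sub>n z ^ (n - 1)\<close>, over the complex numbers so that
  roots are complex roots.\<close>

definition coeff_poly :: "real ^ 'n::{finite,linorder} \<Rightarrow> complex poly" where
  "coeff_poly c = (\<Sum>i\<in>UNIV. monom (of_real (c $ i)) (coord i - 1))"

text \<open>\<open>1 - z A(z)\<close>, where \<open>A = coeff_poly a\<close>.\<close>

definition ar_poly :: "real ^ 'n::{finite,linorder} \<Rightarrow> complex poly" where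
  "ar_poly a = 1 - [:0, 1:] * coeff_poly a"

text \<open>The set \<open>\<Omega>\<close> of parameters whose autoregressive roots have modulus greater than \<open>1 / h\<close>.\<close>

definition stable_params ::
    "real \<Rightarrow> (real ^ ('p::{finite,linorder} + 'q::{finite,linorder})) set" where
  "stable_params h = {v. \<forall>x. poly (ar_poly (ar_part v)) x = 0 \<longrightarrow> cmod x > 1 / h}"

text \<open>\<open>[y\<^sub>k\<^sub>-\<^sub>1, \<dots>, y\<^sub>k\<^sub>-\<^sub>p, u\<^sub>k, \<dots>, u\<^sub>k\<^sub>-\<^sub>q\<^sub>+\<^sub>1]\<close>; times are integers because initial values sit at
  nonpositive times.\<close>

definition regressor ::
    "(int \<Rightarrow> real) \<Rightarrow> (int \<Rightarrow> real) \<Rightarrow> int \<Rightarrow> real ^ ('p::{finite,linorder} + 'q::{finite,linorder})"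
  where
  "regressor y u k = (\<chi> r. case r of
      Inl i \<Rightarrow> y (k - int (coord i))
    | Inr j \<Rightarrow> u (k - int (coord j) + 1))"

text \<open>\<open>[u\<^sub>k, u\<^sub>k\<^sub>-\<^sub>1, \<dots>, u\<^sub>k\<^sub>-\<^sub>p\<^sub>-\<^sub>q\<^sub>+\<^sub>1]\<close>.\<close>

definition input_window ::
    "(int \<Rightarrow> real) \<Rightarrow> int \<Rightarrow> real ^ ('p::{finite,linorder} + 'q::{finite,linorder})" where
  "input_window u k = (\<chi> r. case r of
      Inl i \<Rightarrow> u (k - int (coord i) + 1)
    | Inr j \<Rightarrow> u (k - int CARD('p) - int (coord j) + 1))"

definition outer :: "real ^ 'n \<Rightarrow> real ^ 'n ^ 'n" where
  "outer x = (\<chi> i j. x $ i * x $ j)"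

definition psd_le :: "real ^ 'n ^ 'n::finite \<Rightarrow> real ^ 'n ^ 'n \<Rightarrow> bool" where
  "psd_le X Y \<longleftrightarrow> transpose (Y - X) = Y - X \<and> (\<forall>v. 0 \<le> v \<bullet> ((Y - X) *v v))"

text \<open>Used only for symmetric matrices, whose eigenvalues are all real.\<close>

definition lambda_min :: "real ^ 'n ^ 'n::finite \<Rightarrow> real" where
  "lambda_min X = Min {l. \<exists>v. v \<noteq> 0 \<and> X *v v = l *\<^sub>R v}"

definition complex_spectrum :: "real ^ 'n ^ 'n::finite \<Rightarrow> complex set" where
  "complex_spectrum X = {l. \<exists>v. v \<noteq> 0 \<and> (\<chi> i j. complex_of_real (X $ i $ j)) *v v = l *s v}"

definition spec_radius :: "real ^ 'n ^ 'n::finite \<Rightarrow> real" where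
  "spec_radius X = Max (cmod ` complex_spectrum X)"

definition op_norm :: "real ^ 'n ^ 'n::finite \<Rightarrow> real" where
  "op_norm X = onorm (\<lambda>v. X *v v)"

text \<open>First row \<open>a\<close>, ones on the subdiagonal.\<close>

definition companion :: "(real, 'n::{finite,linorder}) vec \<Rightarrow> ((real, 'n) vec, 'n) vec" where
  "companion a = (\<chi> i j. if coord i = 1 then a $ j else if coord i = coord j + 1 then 1 else 0)"

definition g_bound :: "nat \<Rightarrow> real \<Rightarrow> real" where
  "g_bound p h = (\<Sum>i = 1..p. (real (p choose i))\<^sup>2 * h ^ (2 * i))"

end

theory Submission
  imports Defs "HOL-Computational_Algebra.Fundamental_Theorem_Algebra"
begin

text \<open>
  Write \<open>e\<^sub>k = \<theta>'\<^sub>k - \<theta>\<close> for the estimation error, \<open>\<phi>'\<^sub>k\<close> for the estimated regressor and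
  \<open>X\<^sub>k\<close> for the window of errors in the estimated outputs. The latter obeys
  \<open>X\<^sub>k = A X\<^sub>k\<^sub>-\<^sub>1 + (\<phi>'\<^sub>k \<bullet> e\<^sub>k) b\<close> with \<open>A\<close> the companion matrix and \<open>b\<close> the first unit vector.
  Because \<open>e\<^sub>k\<close> moves by \<open>O(1 / k)\<close> per step, this gives
  \<open>\<parallel>X\<^sub>k\<parallel> \<le> M M\<^sub>2 / (1 - h\<^sub>1) \<parallel>e\<^sub>k\<parallel> + O(1 / k)\<close> uniformly in the noise. By the mean value theorem the
  conditional drift of \<open>\<parallel>e\<^sub>k\<parallel>\<^sup>2\<close> is then at most
  \<open>(2 \<gamma> / k) (- f\<^sub>m (\<phi>\<^sub>k \<bullet> e\<^sub>k\<^sub>-\<^sub>1)\<^sup>2 + G \<parallel>e\<^sub>k\<^sub>-\<^sub>1\<parallel>\<^sup>2) + O(1 / k\<^sup>2)\<close>, where \<open>G\<close> is the term subtracted in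
  the gap condition. Summing over a block of \<open>N\<close> steps, freezing \<open>e\<close> at the start of the block and
  using the excitation of \<open>\<phi>\<close> yields
  \<open>r\<^sub>k\<^sub>+\<^sub>N \<le> (1 - \<alpha> N / k) r\<^sub>k + O(1 / k\<^sup>2)\<close> for the mean square errors, with
  \<open>\<alpha> = 2 \<gamma> (f\<^sub>m \<delta> - G) > 1\<close>, which forces \<open>r\<^sub>k = O(1 / k)\<close>.
\<close>

section \<open>Coefficients of stable autoregressive polynomials\<close>

text \<open>P is a product of at most n factors 1 - x / r with |1 / r| < h, so its coefficients are
  dominated by those of (1 + h x)^n. The induction peels off one factor, and Pascal's rule adds up
  the binomial coefficients.\<close>

lemma coeff_bound_of_roots:
  fixes P :: "complex poly"
  assumes "h > 0" "poly P 0 = 1" "\<And>x. poly P x = 0 \<Longrightarrow> cmod x > 1 / h" "degree P \<le> n"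
  shows "cmod (coeff P i) \<le> real (n choose i) * h ^ i"
  using assms(2-)
proof (induction n arbitrary: P i)
  case 0
  then obtain c where "P = [:c:]"
    using degree_eq_zeroE by blast
  with 0 show ?case
    by (cases i) auto
next
  case (Suc n)
  show ?case
  proof (cases "degree P = 0")
    case True
    then obtain c where c: "P = [:c:]"
      using degree_eq_zeroE by blast
    show ?thesis
    proof (cases i)
      case 0
      with Suc.prems c show ?thesis by simp
    next
      case (Suc j)
      with c \<open>h > 0\<close> show ?thesis by simp
    qed
  next
    case False
    then obtain r where r: "poly P r = 0"
      using fundamental_theorem_of_algebra[of P] by (auto simp: constant_degree)
    then have r1: "cmod r > 1 / h"
      using Suc.prems by blast
    with \<open>h > 0\<close> have r0: "r \<noteq> 0"
      by (auto simp: field_simps)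
    have inv: "cmod (inverse r) \<le> h"
      using r1 r0 \<open>h > 0\<close> by (simp add: norm_inverse norm_divide field_simps)
    obtain Q0 where Q0: "P = [:- r, 1:] * Q0"
      using r poly_eq_0_iff_dvd by (metis dvdE)
    \<comment> \<open>Moving the factor - r into the cofactor turns x - r into 1 - x / r and gives
      the cofactor constant term 1, as the induction hypothesis demands.\<close>
    define Q where "Q = smult (- r) Q0"
    have PQ: "P = [:1, - inverse r:] * Q"
      using Q0 r0 by (simp add: Q_def smult_add_right)
    have "Q \<noteq> 0"
      using PQ Suc.prems(1) by auto
    then have deg: "degree P = Suc (degree Q)"
      using r0 unfolding PQ by (subst degree_mult_eq) auto
    have IH: "cmod (coeff Q j) \<le> real (n choose j) * h ^ j" for j
    proof (rule Suc.IH)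
      show "poly Q 0 = 1"
        using PQ Suc.prems(1) by simp
      show "degree Q \<le> n"
        using deg Suc.prems(3) by simp
      show "cmod x > 1 / h" if "poly Q x = 0" for x
        using that Suc.prems(2)[of x] by (simp add: PQ)
    qed
    show ?thesis
    proof (cases i)
      case 0
      with Suc.prems show ?thesis
        by (simp add: poly_0_coeff_0)
    next
      case (Suc j)
      have "cmod (coeff P i) = cmod (coeff Q (Suc j) - inverse r * coeff Q j)"
        by (simp add: PQ Suc coeff_pCons)
      also have "\<dots> \<le> cmod (coeff Q (Suc j)) + cmod (inverse r) * cmod (coeff Q j)"
        by (metis norm_mult norm_triangle_ineq4)
      also have "\<dots> \<le> real (n choose Suc j) * h ^ Suc j + h * (real (n choose j) * h ^ j)"
        using IH inv \<open>h > 0\<close> by (intro add_mono mult_mono IH) auto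
      also have "\<dots> = real (Suc n choose i) * h ^ i"
        by (simp add: Suc algebra_simps)
      finally show ?thesis .
    qed
  qed
qed

lemma coord_bounds: "1 \<le> coord i" "coord (i::'n::{finite,linorder}) \<le> CARD('n)"
  using bij_betw_coord[where 'n='n] by (auto simp: bij_betw_def)

lemma coord_eq_iff [simp]: "coord i = coord j \<longleftrightarrow> i = j"
  using bij_betw_coord by (metis UNIV_I bij_betw_inv_into_left)

lemma obtain_coord:
  assumes "1 \<le> k" "k \<le> CARD('n::{finite,linorder})"
  obtains i :: "'n::{finite,linorder}" where "coord i = k"
  using assms bij_betw_coord[where 'n='n] by (metis atLeastAtMost_iff bij_betw_imp_surj_on imageE)

lemma sum_coord:
  "(\<Sum>i\<in>UNIV. g (coord (i::'n::{finite,linorder}))) = (\<Sum>k=1..CARD('n). g k)"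
  by (rule sum.reindex_bij_betw[OF bij_betw_coord])

lemma coeff_ar_poly:
  fixes a :: "real ^ 'n::{finite,linorder}"
  shows "coeff (ar_poly a) (coord i) = - complex_of_real (a $ i)"
proof -
  have "coeff (coeff_poly a) (coord i - 1) = (\<Sum>j\<in>UNIV. if j = i then complex_of_real (a $ j) else 0)"
    unfolding coeff_poly_def coeff_sum
  proof (rule sum.cong[OF refl])
    fix j
    have "coord j - 1 = coord i - 1 \<longleftrightarrow> j = i"
      by (metis coord_bounds(1) coord_eq_iff le_add_diff_inverse)
    then show "coeff (monom (complex_of_real (a $ j)) (coord j - 1)) (coord i - 1)
        = (if j = i then complex_of_real (a $ j) else 0)"
      by (simp add: coeff_monom)
  qed
  moreover obtain c where "coord i = Suc c"
    using coord_bounds(1)[of i] by (cases "coord i") auto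
  ultimately show ?thesis
    by (simp add: ar_poly_def)
qed

lemma degree_ar_poly:
  fixes a :: "real ^ 'n::{finite,linorder}"
  shows "degree (ar_poly a) \<le> CARD('n)"
proof -
  have "degree (coeff_poly a) \<le> CARD('n) - 1"
    unfolding coeff_poly_def
  proof (rule degree_sum_le)
    fix j :: 'n
    show "degree (monom (complex_of_real (a $ j)) (coord j - 1)) \<le> CARD('n) - 1"
      using coord_bounds(2)[of j] by (intro order.trans[OF degree_monom_le]) auto
  qed simp
  then have "Suc (degree (coeff_poly a)) \<le> CARD('n)"
    using zero_less_card_finite[where 'a='n] by linarith
  then have "degree ([:0, 1:] * coeff_poly a) \<le> CARD('n)"
    using degree_pCons_le[of 0 "coeff_poly a"] by simp
  then show ?thesis
    unfolding ar_poly_def by (intro degree_diff_le) auto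
qed

text \<open>The autoregressive coefficients are, up to sign, the nonconstant coefficients of
  \<open>ar_poly\<close>; squaring the binomial bound with n = p and summing produces
  \<open>g_bound\<close>.\<close>

lemma norm_ar_part_le:
  fixes v :: "real ^ ('p::{finite,linorder} + 'q::{finite,linorder})"
  assumes "h > 0" "v \<in> stable_params h"
  shows "norm (ar_part v) \<le> sqrt (g_bound CARD('p) h)"
proof -
  let ?a = "ar_part v"
  have a: "\<bar>?a $ i\<bar> \<le> real (CARD('p) choose coord i) * h ^ coord i" for i
  proof -
    have "cmod (coeff (ar_poly ?a) (coord i)) \<le> real (CARD('p) choose coord i) * h ^ coord i"
      using assms degree_ar_poly[of ?a]
      by (intro coeff_bound_of_roots) (auto simp: stable_params_def ar_poly_def)
    then show ?thesis
      by (simp add: coeff_ar_poly)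
  qed
  have "(\<Sum>i\<in>UNIV. (?a $ i)\<^sup>2) \<le> (\<Sum>i\<in>(UNIV::'p set). (real (CARD('p) choose coord i) * h ^ coord i)\<^sup>2)"
    using a by (intro sum_mono) (metis abs_ge_zero power2_abs power_mono)
  also have "\<dots> = g_bound CARD('p) h"
    unfolding g_bound_def by (subst sum_coord) (simp add: power_mult_distrib power_mult mult.commute flip: power_mult)
  finally show ?thesis
    by (simp add: norm_vec_def L2_set_def)
qed

section \<open>Powers of the companion matrix\<close>

lemma norm_vector_scalar_mult: "norm (c *s v) = cmod c * norm v" for v :: "complex ^ 'n"
  by (simp add: norm_vec_def L2_set_def norm_mult power_mult_distrib real_sqrt_mult
      flip: sum_distrib_left)

text \<open>The vector P(X) v. Iterates of the linear map stand in for matrix powers, so that bounds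
  on orbits can be stated without translation.\<close>

definition poly_apply :: "complex poly \<Rightarrow> complex ^ 'n ^ 'n \<Rightarrow> complex ^ 'n \<Rightarrow> complex ^ 'n" where
  "poly_apply P X v = (\<Sum>i\<le>degree P. coeff P i *s (((*v) X ^^ i) v))"

lemma poly_apply_eq:
  assumes "degree P \<le> n"
  shows "poly_apply P X v = (\<Sum>i\<le>n. coeff P i *s (((*v) X ^^ i) v))"
  unfolding poly_apply_def
  by (rule sum.mono_neutral_left) (use assms in \<open>auto simp: coeff_eq_0\<close>)

lemma poly_apply_0 [simp]: "poly_apply 0 X v = 0"
  by (simp add: poly_apply_def)

text \<open>A Horner step that puts the extra X on the vector; as a simplification rule it drives
  the inductions over polynomials below, which therefore keep the vector arbitrary.\<close>

lemma poly_apply_pCons [simp]: "poly_apply (pCons c P) X v = c *s v + poly_apply P X (X *v v)"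
  by (subst poly_apply_eq[OF degree_pCons_le])
    (simp add: sum.atMost_Suc_shift poly_apply_def funpow_swap1 del: sum.atMost_Suc)

lemma poly_apply_add: "poly_apply (P + Q) X v = poly_apply P X v + poly_apply Q X v"
  by (induction P Q arbitrary: v rule: poly_induct2) (auto simp: vector_sadd_rdistrib algebra_simps)

lemma poly_apply_smult: "poly_apply (smult c P) X v = c *s poly_apply P X v"
  by (induction P arbitrary: v) (auto simp: vector_add_ldistrib vector_smult_assoc)

lemma poly_apply_diff: "poly_apply (P - Q) X v = poly_apply P X v - poly_apply Q X v"
  using poly_apply_add[of "P - Q" Q X v] by simp

lemma poly_apply_sum: "poly_apply (\<Sum>i\<in>I. P i) X v = (\<Sum>i\<in>I. poly_apply (P i) X v)"
  by (induction I rule: infinite_finite_induct) (auto simp: poly_apply_add)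

lemma poly_apply_monom: "poly_apply (monom c k) X v = c *s ((*v) X ^^ k) v"
  by (induction k arbitrary: v) (auto simp: monom_0 monom_Suc funpow_swap1)

lemma poly_apply_vec_add: "poly_apply P X (v + w) = poly_apply P X v + poly_apply P X w"
  by (induction P arbitrary: v w) (auto simp: vector_add_ldistrib matrix_vector_right_distrib algebra_simps)

lemma poly_apply_vec_smult: "poly_apply P X (c *s v) = c *s poly_apply P X v"
  by (induction P arbitrary: v) (auto simp: vector_add_ldistrib vector_smult_assoc mult.commute
      vector_scalar_commute)

lemma poly_apply_commute: "poly_apply P X (X *v v) = X *v poly_apply P X v"
  by (induction P arbitrary: v) (auto simp: matrix_vector_right_distrib vector_scalar_commute)

lemma poly_apply_funpow: "poly_apply P X (((*v) X ^^ k) v) = ((*v) X ^^ k) (poly_apply P X v)"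
  by (induction k) (auto simp: poly_apply_commute)

text \<open>Polynomials in X commute, so the linear factor may act first. If the product annihilates
  v, then the cofactor annihilates X v - c v.\<close>

lemma poly_apply_linear_factor:
  "poly_apply ([:- c, 1:] * Q) X v = poly_apply Q X (X *v v - c *s v)"
proof -
  have "[:- c, 1:] * Q = pCons 0 Q - smult c Q"
    by simp
  moreover have "poly_apply Q X (X *v v) = poly_apply Q X (X *v v - c *s v) + c *s poly_apply Q X v"
    by (simp flip: poly_apply_vec_add poly_apply_vec_smult)
  ultimately show ?thesis
    by (simp only: poly_apply_diff poly_apply_smult poly_apply_pCons) simp
qed

lemma poly_apply_eigenvector:
  assumes "X *v v = l *s v"
  shows "poly_apply P X v = poly P l *s v"
  by (induction P) (auto simp: assms poly_apply_vec_smult vector_smult_assoc vector_sadd_rdistrib)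

lemma funpow_mult_vec_add:
  "((*v) X ^^ k) (v + w) = ((*v) X ^^ k) v + ((*v) X ^^ k) w" for X :: "'a::semiring_1 ^ 'n ^ 'n"
  by (induction k) (auto simp: matrix_vector_right_distrib)

lemma funpow_mult_vec_smult:
  "((*v) X ^^ k) (c *s v) = c *s ((*v) X ^^ k) v" for X :: "'a::field ^ 'n ^ 'n"
  by (induction k) (auto simp: vector_scalar_commute)

text \<open>Splitting off one root \<open>l\<close> of \<open>P\<close>: with \<open>w = X v - l v\<close>, which is killed by the cofactor,
  \<open>X ^ (k + 1) v = l X ^ k v + X ^ k w\<close> and \<open>\<parallel>w\<parallel> \<le> 2 L \<parallel>v\<parallel>\<close>. This costs a factor \<open>1 + 2 / \<epsilon>\<close> per root
  beyond the first and replaces a Schur triangularization of \<open>X\<close>.\<close>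

lemma norm_funpow_le_of_annihilated:
  fixes X :: "complex ^ 'n::finite ^ 'n"
  assumes L: "\<And>v. norm (X *v v) \<le> L * norm v" and "0 \<le> \<rho>" "\<rho> \<le> L" "L > 0" "\<epsilon> > 0"
    and "P \<noteq> 0" "\<And>x. poly P x = 0 \<Longrightarrow> cmod x \<le> \<rho>" "poly_apply P X v = 0"
  shows "norm (((*v) X ^^ k) v) \<le> (1 + 2 / \<epsilon>) ^ (degree P - 1) * (\<rho> + \<epsilon> * L) ^ k * norm v"
proof -
  \<comment> \<open>For degree 0, annihilation forces v = 0, so the constant 0 suffices there.
    Starting from 0 saves one factor and leads to the exponent \<open>degree P - 1\<close>.\<close>
  define K where "K n = (if n = 0 then 0 else (1 + 2 / \<epsilon>) ^ (n - 1))" for n :: nat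
  have K0: "K n \<ge> 0" for n
    using \<open>\<epsilon> > 0\<close> by (simp add: K_def)
  have K_Suc: "1 + K n * (2 / \<epsilon>) \<le> K (Suc n)" for n
  proof (cases n)
    case (Suc j)
    have "1 \<le> (1 + 2 / \<epsilon>) ^ j"
      using \<open>\<epsilon> > 0\<close> by (intro one_le_power) auto
    moreover have "(1 + 2 / \<epsilon>) ^ n = (1 + 2 / \<epsilon>) ^ j + (1 + 2 / \<epsilon>) ^ j * (2 / \<epsilon>)"
      unfolding Suc power_Suc by (simp only: distrib_right mult_1 mult.commute)
    ultimately show ?thesis
      by (simp add: K_def Suc)
  qed (simp add: K_def)
  have "norm (((*v) X ^^ k) v) \<le> K n * (\<rho> + \<epsilon> * L) ^ k * norm v"
    if "degree P = n" "P \<noteq> 0" "\<And>x. poly P x = 0 \<Longrightarrow> cmod x \<le> \<rho>" "poly_apply P X v = 0" for n P v k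
    using that
  proof (induction n arbitrary: P v k)
    case 0
    then obtain c where "P = [:c:]" "c \<noteq> 0"
      using degree_eq_zeroE by (metis pCons_0_0)
    with 0 have "v = 0" by simp
    moreover have "((*v) X ^^ k) 0 = 0"
      by (induction k) auto
    ultimately show ?case by simp
  next
    case (Suc n)
    obtain l where l: "poly P l = 0"
      using fundamental_theorem_of_algebra[of P] Suc.prems(1) by (auto simp: constant_degree)
    then obtain Q where Q: "P = [:- l, 1:] * Q"
      by (metis poly_eq_0_iff_dvd dvdE)
    have l\<rho>: "cmod l \<le> \<rho>"
      using l Suc.prems by blast
    have Q0: "Q \<noteq> 0"
      using Q Suc.prems by auto
    then have "degree P = Suc (degree Q)"
      unfolding Q by (subst degree_mult_eq) auto
    then have degQ: "degree Q = n"
      using Suc.prems by simp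
    define w where "w = X *v v - l *s v"
    have "poly_apply Q X w = 0"
      using Suc.prems(4) by (simp only: Q poly_apply_linear_factor w_def)
    then have IH: "norm (((*v) X ^^ k) w) \<le> K n * (\<rho> + \<epsilon> * L) ^ k * norm w" for k
      using Suc.IH[OF degQ Q0] Suc.prems(3) by (simp add: Q)
    have "norm w \<le> norm (X *v v) + norm (l *s v)"
      unfolding w_def by (rule norm_triangle_ineq4)
    also have "\<dots> \<le> L * norm v + L * norm v"
      using L l\<rho> \<open>\<rho> \<le> L\<close> by (intro add_mono) (auto simp: norm_vector_scalar_mult intro!: mult_right_mono)
    finally have w: "norm w \<le> 2 * L * norm v" by simp
    let ?r = "\<rho> + \<epsilon> * L"
    have r: "?r \<ge> 0" using assms by simp
    have "norm (((*v) X ^^ k) v) \<le> (1 + K n * (2 / \<epsilon>)) * ?r ^ k * norm v" for k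
    proof (induction k)
      case 0
      then show ?case
        using K0[of n] \<open>\<epsilon> > 0\<close> by (simp add: distrib_right)
    next
      case (Suc k)
      have "((*v) X ^^ Suc k) v = ((*v) X ^^ k) (l *s v + w)"
        by (simp add: w_def funpow_swap1)
      also have "\<dots> = l *s ((*v) X ^^ k) v + ((*v) X ^^ k) w"
        by (simp only: funpow_mult_vec_add funpow_mult_vec_smult)
      finally have "norm (((*v) X ^^ Suc k) v) \<le> cmod l * norm (((*v) X ^^ k) v) + norm (((*v) X ^^ k) w)"
        by (metis norm_triangle_ineq norm_vector_scalar_mult)
      also have "\<dots> \<le> \<rho> * ((1 + K n * (2 / \<epsilon>)) * ?r ^ k * norm v) + K n * ?r ^ k * (2 * L * norm v)"
        using Suc l\<rho> r K0[of n] w assms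
        by (intro add_mono mult_mono order.trans[OF IH mult_left_mono]) auto
      \<comment> \<open>Writing 2 L as (2 / \<epsilon>) (\<epsilon> L) charges the contribution of w
        to the slack \<epsilon> L in the rate instead of to \<rho>.\<close>
      also have "\<dots> = ((1 + K n * (2 / \<epsilon>)) * \<rho> + K n * (2 / \<epsilon>) * (\<epsilon> * L)) * ?r ^ k * norm v"
        using \<open>\<epsilon> > 0\<close> by (simp add: algebra_simps)
      also have "\<dots> \<le> ((1 + K n * (2 / \<epsilon>)) * \<rho> + (1 + K n * (2 / \<epsilon>)) * (\<epsilon> * L)) * ?r ^ k * norm v"
        using r assms by (intro mult_right_mono add_mono) auto
      also have "\<dots> = (1 + K n * (2 / \<epsilon>)) * ?r ^ Suc k * norm v"
        by (simp add: algebra_simps)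
      finally show ?case .
    qed
    from this[of k] show ?case
      using r by (elim order.trans) (intro mult_right_mono K_Suc, auto)
  qed
  from this[of P "degree P"] assms have "norm (((*v) X ^^ k) v) \<le> K (degree P) * (\<rho> + \<epsilon> * L) ^ k * norm v"
    by blast
  also have "\<dots> \<le> (1 + 2 / \<epsilon>) ^ (degree P - 1) * (\<rho> + \<epsilon> * L) ^ k * norm v"
    using assms by (intro mult_right_mono) (auto simp: K_def)
  finally show ?thesis .
qed

section \<open>Complexification and operator norms\<close>

abbreviation complexify :: "real ^ 'n \<Rightarrow> complex ^ 'n" where
  "complexify v \<equiv> (\<chi> i. complex_of_real (v $ i))"

abbreviation complexify_matrix :: "real ^ 'n ^ 'm \<Rightarrow> complex ^ 'n ^ 'm" where
  "complexify_matrix X \<equiv> (\<chi> i j. complex_of_real (X $ i $ j))"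

lemma norm_complexify: "norm (complexify v) = norm v"
  by (simp add: norm_vec_def)

lemma complexify_mult_vec: "complexify_matrix X *v complexify v = complexify (X *v v)"
  by (simp add: matrix_vector_mult_def vec_eq_iff)

lemma complexify_funpow:
  fixes X :: "real ^ 'n ^ 'n"
  shows
  "((*v) (complexify_matrix X) ^^ k) (complexify v) = complexify (((*v) X ^^ k) v)"
  by (induction k) (auto simp: complexify_mult_vec)

lemma norm_mult_vec_le_op_norm: "norm (X *v v) \<le> op_norm X * norm v" for X :: "real ^ 'n::finite ^ 'n"
  unfolding op_norm_def by (rule onorm) simp

lemma op_norm_nonneg: "0 \<le> op_norm X" for X :: "real ^ 'n::finite ^ 'n"
  unfolding op_norm_def by (rule onorm_pos_le) simp

lemma op_norm_pos: "X \<noteq> 0 \<Longrightarrow> 0 < op_norm X" for X :: "real ^ 'n::finite ^ 'n"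
proof -
  assume "X \<noteq> 0"
  then obtain v where "X *v v \<noteq> 0"
    by (metis matrix_eq matrix_vector_mult_0)
  then have "0 < norm (X *v v)" by simp
  also have "\<dots> \<le> op_norm X * norm v" by (rule norm_mult_vec_le_op_norm)
  finally show "0 < op_norm X"
    using op_norm_nonneg[of X] by (cases "op_norm X = 0") auto
qed

text \<open>A real matrix acts separately on real and imaginary parts, whose squared norms add up;
  hence passing to complex vectors does not enlarge the operator norm.\<close>

lemma norm_complexify_mult_vec_le:
  fixes X :: "real ^ 'n::finite ^ 'n"
  shows "norm (complexify_matrix X *v v) \<le> op_norm X * norm v"
proof -
  define re im where "re = (\<chi> i. Re (v $ i))" and "im = (\<chi> i. Im (v $ i))"
  have split: "(norm w)\<^sup>2 = (norm (\<chi> i. Re (w $ i)))\<^sup>2 + (norm (\<chi> i. Im (w $ i)))\<^sup>2" for w :: "complex ^ 'n"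
    by (simp add: norm_vec_def L2_set_def sum_nonneg cmod_power2 sum.distrib)
  have "(\<chi> i. Re ((complexify_matrix X *v v) $ i)) = X *v re"
    "(\<chi> i. Im ((complexify_matrix X *v v) $ i)) = X *v im"
    by (simp_all add: re_def im_def vec_eq_iff matrix_vector_mult_def)
  then have "(norm (complexify_matrix X *v v))\<^sup>2 = (norm (X *v re))\<^sup>2 + (norm (X *v im))\<^sup>2"
    by (simp add: split)
  also have "\<dots> \<le> (op_norm X * norm re)\<^sup>2 + (op_norm X * norm im)\<^sup>2"
    by (intro add_mono power_mono norm_mult_vec_le_op_norm) auto
  also have "\<dots> = (op_norm X * norm v)\<^sup>2"
    by (simp add: split[of v] re_def im_def power_mult_distrib distrib_left)
  finally show ?thesis
    by (rule power2_le_imp_le) (simp add: op_norm_nonneg)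
qed

section \<open>Characteristic polynomial and spectrum of the companion matrix\<close>

definition companion_poly :: "real ^ 'n::{finite,linorder} \<Rightarrow> complex poly" where
  "companion_poly a = monom 1 CARD('n) - (\<Sum>j\<in>UNIV. monom (complex_of_real (a $ j)) (CARD('n) - coord j))"

lemma companion_mult_vec_first:
  "coord i = 1 \<Longrightarrow> (complexify_matrix (companion a) *v v) $ i = (\<Sum>j\<in>UNIV. complex_of_real (a $ j) * v $ j)"
  by (simp add: companion_def matrix_vector_mult_def)

lemma companion_mult_vec_shift:
  fixes i j :: "'n::{finite,linorder}"
  assumes "coord i = coord j + 1"
  shows "(complexify_matrix (companion a) *v v) $ i = v $ j"
proof -
  have "coord i \<noteq> 1" using assms coord_bounds(1)[of j] by simp
  then have "(complexify_matrix (companion a) *v v) $ i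
      = (\<Sum>j'\<in>UNIV. complex_of_real (if j = j' then 1 else 0) * v $ j')"
    by (simp add: companion_def matrix_vector_mult_def assms)
  also have "\<dots> = (\<Sum>j'\<in>UNIV. if j = j' then v $ j' else 0)"
    by (rule sum.cong) auto
  finally show ?thesis by simp
qed

lemma companion_mult_vec_real:
  fixes i j :: "'n::{finite,linorder}"
  shows "coord i = 1 \<Longrightarrow> (companion a *v v) $ i = a \<bullet> v"
    and "coord i = coord j + 1 \<Longrightarrow> (companion a *v v) $ i = v $ j"
proof -
  have of_real: "complex_of_real ((companion a *v v) $ i) = (complexify_matrix (companion a) *v complexify v) $ i"
    by (simp add: complexify_mult_vec)
  show "(companion a *v v) $ i = a \<bullet> v" if "coord i = 1"
    using that by (simp add: companion_def matrix_vector_mult_def inner_vec_def)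
  show "(companion a *v v) $ i = v $ j" if "coord i = coord j + 1"
    using of_real by (simp only: companion_mult_vec_shift[OF that] vec_lambda_beta of_real_eq_iff)
qed

text \<open>Each multiplication moves the entries down by one position. Thus every entry of v
  reappears as the last entry of some iterate, which reduces the annihilation lemma to one
  coordinate.\<close>

lemma companion_funpow_shift:
  fixes i j :: "'n::{finite,linorder}"
  assumes "coord i = coord j + k"
  shows "((*v) (complexify_matrix (companion a)) ^^ k) v $ i = v $ j"
  using assms
proof (induction k arbitrary: v j)
  case (Suc k)
  have "coord j + 1 \<in> {1..CARD('n)}"
    using Suc.prems coord_bounds[of i] by auto
  then obtain j' :: 'n where j': "coord j' = coord j + 1"
    using obtain_coord by (metis atLeastAtMost_iff)
  then show ?case
    using Suc.IH[of j' "complexify_matrix (companion a) *v v"] Suc.prems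
    by (simp add: companion_mult_vec_shift funpow_swap1)
qed simp

lemma coord_Max: "coord (Max UNIV :: 'n::{finite,linorder}) = CARD('n)"
proof -
  have "{..Max UNIV :: 'n} = UNIV" by auto
  then show ?thesis by (simp add: coord_def)
qed

text \<open>Cayley-Hamilton without determinants. In the last coordinate the claim is the equation
  given by the first row of the matrix A. Coordinate i of P(A) v is the last coordinate of A^(n - i)
  P(A) v, and the power commutes with P(A).\<close>

lemma poly_apply_companion_poly:
  fixes a :: "real ^ 'n::{finite,linorder}"
  shows "poly_apply (companion_poly a) (complexify_matrix (companion a)) v = 0"
proof -
  let ?A = "complexify_matrix (companion a)"
  obtain i1 :: 'n where i1: "coord i1 = 1"
    using obtain_coord[of 1] zero_less_card_finite[where 'a='n] by (metis One_nat_def Suc_leI order_refl)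
  have last: "poly_apply (companion_poly a) ?A v $ Max UNIV = 0" for v
  proof -
    have "((*v) ?A ^^ CARD('n)) v $ Max UNIV = ((*v) ?A ^^ (CARD('n) - 1)) (?A *v v) $ Max UNIV"
    proof -
      obtain k where "CARD('n) = Suc k"
        using zero_less_card_finite[where 'a='n] gr0_implies_Suc by blast
      then show ?thesis
        by (simp add: funpow_swap1)
    qed
    also have "\<dots> = (?A *v v) $ i1"
      by (rule companion_funpow_shift) (simp add: coord_Max i1)
    also have "\<dots> = (\<Sum>j\<in>UNIV. complex_of_real (a $ j) * v $ j)"
      using i1 by (rule companion_mult_vec_first)
    also have "\<dots> = (\<Sum>j\<in>UNIV. complex_of_real (a $ j) * ((*v) ?A ^^ (CARD('n) - coord j)) v $ Max UNIV)"
      by (intro sum.cong arg_cong2[where f="(*)"] refl companion_funpow_shift[symmetric])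
        (simp add: coord_Max coord_bounds)
    finally show ?thesis
      by (simp add: companion_poly_def poly_apply_diff poly_apply_sum poly_apply_monom)
  qed
  have "poly_apply (companion_poly a) ?A v $ i = 0" for i
    using companion_funpow_shift[of "Max UNIV" i "CARD('n) - coord i" a "poly_apply (companion_poly a) ?A v"]
    by (simp add: coord_Max coord_bounds last flip: poly_apply_funpow)
  then show ?thesis by (simp add: vec_eq_iff)
qed

lemma degree_companion_poly:
  fixes a :: "real ^ 'n::{finite,linorder}"
  shows "degree (companion_poly a) = CARD('n)"
proof -
  have "degree (\<Sum>j\<in>UNIV. monom (complex_of_real (a $ j)) (CARD('n) - coord j)) \<le> CARD('n) - 1"
  proof (rule degree_sum_le)
    fix j :: 'n
    show "degree (monom (complex_of_real (a $ j)) (CARD('n) - coord j)) \<le> CARD('n) - 1"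
      using coord_bounds(1)[of j] by (intro order.trans[OF degree_monom_le]) auto
  qed simp
  then have "degree (- (\<Sum>j\<in>UNIV. monom (complex_of_real (a $ j)) (CARD('n) - coord j)))
      < degree (monom (1::complex) CARD('n))"
    using zero_less_card_finite[where 'a='n] by (simp only: degree_minus degree_monom_eq one_neq_zero not_False_eq_True)
  then show ?thesis
    unfolding companion_poly_def diff_conv_add_uminus
    by (subst degree_add_eq_left) (auto simp: degree_monom_eq)
qed

lemma companion_poly_nonzero: "companion_poly (a :: real ^ 'n::{finite,linorder}) \<noteq> 0"
  using degree_companion_poly[of a] by (metis degree_0 less_irrefl zero_less_card_finite)

lemma complex_spectrum_companion:
  fixes a :: "real ^ 'n::{finite,linorder}"
  shows "complex_spectrum (companion a) = {x. poly (companion_poly a) x = 0}"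
proof (intro equalityI subsetI)
  fix l assume "l \<in> complex_spectrum (companion a)"
  then obtain v where "v \<noteq> 0" "complexify_matrix (companion a) *v v = l *s v"
    by (auto simp: complex_spectrum_def)
  then show "l \<in> {x. poly (companion_poly a) x = 0}"
    using poly_apply_eigenvector[of "complexify_matrix (companion a)" v l "companion_poly a"]
    by (simp add: poly_apply_companion_poly)
next
  fix l assume "l \<in> {x. poly (companion_poly a) x = 0}"
  then have root: "l ^ CARD('n) = (\<Sum>j\<in>UNIV. complex_of_real (a $ j) * l ^ (CARD('n) - coord j))"
    by (simp add: companion_poly_def poly_monom poly_sum)
  \<comment> \<open>The eigenvector (l^(n - 1), ..., l, 1): the shift rows hold by construction and
    the first row is the root equation. Its last entry 1 makes it nonzero even for l = 0.\<close>
  define v where "v = (\<chi> i::'n. l ^ (CARD('n) - coord i))"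
  have "v $ Max UNIV = 1"
    by (simp add: v_def coord_Max)
  then have "v \<noteq> 0" by auto
  moreover have "complexify_matrix (companion a) *v v = l *s v"
    unfolding vec_eq_iff
  proof
    fix i :: 'n
    have eq: "l * l ^ (CARD('n) - coord i) = l ^ (CARD('n) - (coord i - 1))"
      using coord_bounds[of i] by (simp flip: power_Suc add: Suc_diff_le)
    show "(complexify_matrix (companion a) *v v) $ i = (l *s v) $ i"
    proof (cases "coord i = 1")
      case True
      with eq show ?thesis
        by (simp add: companion_mult_vec_first v_def flip: root)
    next
      case False
      then have "coord i - 1 \<in> {1..CARD('n)}"
        using coord_bounds[of i] by auto
      then obtain j :: 'n where j: "coord j = coord i - 1"
        using obtain_coord by (metis atLeastAtMost_iff)
      then have ij: "coord i = coord j + 1"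
        using False coord_bounds[of i] by simp
      show ?thesis
        unfolding companion_mult_vec_shift[OF ij] using eq j by (simp add: v_def)
    qed
  qed
  ultimately show "l \<in> complex_spectrum (companion a)"
    unfolding complex_spectrum_def by blast
qed

text \<open>The spectrum is a root set, hence finite, and nonempty by the fundamental theorem of
  algebra; only then does \<open>Max\<close> in \<open>spec_radius\<close> dominate an eigenvalue
  modulus.\<close>

lemma spec_radius_companion_nonneg: "0 \<le> spec_radius (companion (a :: real ^ 'n::{finite,linorder}))"
proof -
  obtain x where "poly (companion_poly a) x = 0"
    using fundamental_theorem_of_algebra[of "companion_poly a"] degree_companion_poly[of a]
    by (auto simp: constant_degree)
  moreover have "finite (complex_spectrum (companion a))"
    unfolding complex_spectrum_companion by (rule poly_roots_finite[OF companion_poly_nonzero])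
  ultimately have "cmod x \<le> spec_radius (companion a)"
    unfolding spec_radius_def by (intro Max_ge) (auto simp: complex_spectrum_companion)
  then show ?thesis
    using norm_ge_zero order.trans by blast
qed

text \<open>The bound for annihilated vectors, with \<rho> the spectral radius, L the operator norm
  and P the characteristic polynomial, read back on real vectors.\<close>

lemma norm_companion_funpow_le:
  fixes a :: "real ^ 'n::{finite,linorder}"
  assumes "a \<noteq> 0" "\<epsilon> > 0"
  shows "norm (((*v) (companion a) ^^ k) v)
    \<le> (1 + 2 / \<epsilon>) ^ (CARD('n) - 1) * (spec_radius (companion a) + \<epsilon> * op_norm (companion a)) ^ k * norm v"
proof -
  let ?A = "complexify_matrix (companion a)" and ?\<rho> = "spec_radius (companion a)"
  have fin: "finite (complex_spectrum (companion a))"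
    unfolding complex_spectrum_companion by (rule poly_roots_finite[OF companion_poly_nonzero])
  have \<rho>: "cmod x \<le> ?\<rho>" if "poly (companion_poly a) x = 0" for x
    using that fin unfolding spec_radius_def by (intro Max_ge) (auto simp: complex_spectrum_companion)
  obtain x where x: "poly (companion_poly a) x = 0"
    using fundamental_theorem_of_algebra[of "companion_poly a"] degree_companion_poly[of a]
    by (auto simp: constant_degree)
  have "0 \<le> ?\<rho>"
    by (rule spec_radius_companion_nonneg)
  moreover have "?\<rho> \<le> op_norm (companion a)"
    unfolding spec_radius_def
  proof (rule Max.boundedI)
    show "cmod ` complex_spectrum (companion a) \<noteq> {}"
      using x by (auto simp: complex_spectrum_companion)
    fix r assume "r \<in> cmod ` complex_spectrum (companion a)"
    then obtain l w where r: "r = cmod l" and w: "w \<noteq> 0" "?A *v w = l *s w"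
      by (auto simp: complex_spectrum_def)
    have "cmod l * norm w \<le> op_norm (companion a) * norm w"
      using norm_complexify_mult_vec_le[of "companion a" w] w by (simp add: norm_vector_scalar_mult)
    with w r show "r \<le> op_norm (companion a)" by simp
  qed (use fin in simp)
  \<comment> \<open>Gives L > 0. The argument uses the first row, since for n = 1 there is no
    subdiagonal to supply a nonzero entry.\<close>
  moreover have "companion a \<noteq> 0"
  proof -
    obtain i1 :: 'n where i1: "coord i1 = 1"
      using obtain_coord[of 1] zero_less_card_finite[where 'a='n] by (metis One_nat_def Suc_leI order_refl)
    obtain j where "a $ j \<noteq> 0"
      using \<open>a \<noteq> 0\<close> by (auto simp: vec_eq_iff)
    then have "companion a $ i1 $ j \<noteq> 0"
      using i1 by (simp add: companion_def)
    then show ?thesis by auto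
  qed
  ultimately have "norm (((*v) ?A ^^ k) (complexify v)) \<le> (1 + 2 / \<epsilon>) ^ (degree (companion_poly a) - 1)
      * (?\<rho> + \<epsilon> * op_norm (companion a)) ^ k * norm (complexify v)"
    using \<rho> assms
    by (intro norm_funpow_le_of_annihilated norm_complexify_mult_vec_le companion_poly_nonzero
        poly_apply_companion_poly op_norm_pos) auto
  then show ?thesis
    by (simp add: complexify_funpow norm_complexify degree_companion_poly)
qed

section \<open>Smallest eigenvalue and excitation\<close>

lemma inner_outer_mult: "v \<bullet> (outer x *v v) = (x \<bullet> v)\<^sup>2" for x :: "real ^ 'n::finite"
proof -
  have "outer x *v v = (x \<bullet> v) *\<^sub>R x"
    by (simp add: vec_eq_iff outer_def matrix_vector_mult_def inner_vec_def sum_distrib_left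
        sum_distrib_right mult.assoc mult.commute mult.left_commute)
  then show ?thesis
    by (simp add: power2_eq_square inner_commute)
qed

lemma transpose_sum: "transpose (\<Sum>i\<in>I. X i) = (\<Sum>i\<in>I. transpose (X i :: real ^ 'n ^ 'n))"
  by (induction I rule: infinite_finite_induct) (auto simp: transpose_def vec_eq_iff)

lemma inner_sum_outer_mult:
  "v \<bullet> ((\<Sum>i\<in>I. outer (x i)) *v v) = (\<Sum>i\<in>I. (x i \<bullet> v)\<^sup>2)" for x :: "'i \<Rightarrow> real ^ 'n::finite"
  by (induction I rule: infinite_finite_induct)
    (auto simp: matrix_vector_mult_add_rdistrib inner_add_right inner_outer_mult)

lemma transpose_sum_outer: "transpose (\<Sum>i\<in>I. outer (x i)) = (\<Sum>i\<in>I. outer (x i :: real ^ 'n::finite))"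
  unfolding transpose_sum by (rule sum.cong) (auto simp: transpose_def outer_def vec_eq_iff)

lemma inner_symmetric_matrix:
  fixes X :: "real ^ 'n ^ 'n::finite"
  assumes "transpose X = X"
  shows "(X *v v) \<bullet> w = v \<bullet> (X *v w)"
  using assms by (metis dot_lmul_matrix transpose_matrix_vector)

text \<open>Makes \<open>Min\<close> in \<open>lambda_min\<close> meaningful: eigenvectors chosen
  for distinct eigenvalues are orthogonal, hence independent, hence finite in number.\<close>

lemma finite_eigenvalues_symmetric:
  fixes X :: "real ^ 'n ^ 'n::finite"
  assumes "transpose X = X"
  shows "finite {l. \<exists>v. v \<noteq> 0 \<and> X *v v = l *\<^sub>R v}"
proof -
  let ?E = "{l. \<exists>v. v \<noteq> 0 \<and> X *v v = l *\<^sub>R v}"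
  define w where "w l = (SOME v. v \<noteq> 0 \<and> X *v v = l *\<^sub>R v)" for l
  have w: "w l \<noteq> 0" "X *v w l = l *\<^sub>R w l" if "l \<in> ?E" for l
    using someI_ex[of "\<lambda>v. v \<noteq> 0 \<and> X *v v = l *\<^sub>R v"] that by (auto simp: w_def)
  have orth: "orthogonal (w l) (w l')" if "l \<in> ?E" "l' \<in> ?E" "l \<noteq> l'" for l l'
  proof -
    have "l * (w l \<bullet> w l') = l' * (w l \<bullet> w l')"
      using inner_symmetric_matrix[OF assms, of "w l" "w l'"] w that by simp
    with that show ?thesis by (simp add: orthogonal_def)
  qed
  have inj: "inj_on w ?E"
    using orth w by (metis (no_types, lifting) inj_onI orthogonal_self)
  have "pairwise orthogonal (w ` ?E)"
    using orth unfolding pairwise_def by blast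
  moreover have "0 \<notin> w ` ?E" using w by force
  ultimately have "independent (w ` ?E)"
    by (rule pairwise_orthogonal_independent)
  then have "finite (w ` ?E)"
    by (rule independent_imp_finite)
  then show ?thesis
    using inj finite_imageD by blast
qed

text \<open>The form attains its minimum l on the unit sphere at some v. If z = X v - l v were
  nonzero, moving from v to v + t z would change the excess of the form over l |v|^2 by 2 t |z|^2 to
  first order, which is negative for small t < 0.\<close>

lemma symmetric_form_minimizer:
  fixes X :: "real ^ 'n ^ 'n::finite"
  assumes sym: "transpose X = X"
  obtains l v where "v \<noteq> 0" "X *v v = l *\<^sub>R v" "\<And>w. l * (w \<bullet> w) \<le> w \<bullet> (X *v w)"
proof -
  have cont: "continuous_on (sphere 0 1) (\<lambda>v. v \<bullet> (X *v v))"
    by (intro continuous_on_inner continuous_on_id linear_continuous_on matrix_vector_mul_bounded_linear)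
  have "sphere (0::real^'n) 1 \<noteq> {}" by simp
  from continuous_attains_inf[OF compact_sphere this cont]
  obtain v where v: "v \<in> sphere 0 1" "\<And>w. w \<in> sphere 0 1 \<Longrightarrow> v \<bullet> (X *v v) \<le> w \<bullet> (X *v w)"
    by blast
  define l where "l = v \<bullet> (X *v v)"
  have vv: "v \<bullet> v = 1" using v by (simp add: dot_square_norm)
  have min: "l * (w \<bullet> w) \<le> w \<bullet> (X *v w)" for w
  proof (cases "w = 0")
    case False
    define n where "n = norm w"
    have n: "n > 0" using False by (simp add: n_def)
    have "l \<le> (w /\<^sub>R n) \<bullet> (X *v (w /\<^sub>R n))"
      unfolding l_def using n by (intro v) (simp add: n_def)
    also have "\<dots> = (w \<bullet> (X *v w)) / n\<^sup>2"
      by (simp add: matrix_vector_mult_scaleR power2_eq_square field_simps)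
    finally show ?thesis
      using n by (simp add: field_simps dot_square_norm n_def)
  qed simp
  have "X *v v - l *\<^sub>R v = 0"
  proof (rule ccontr)
    define z where "z = X *v v - l *\<^sub>R v"
    assume "X *v v - l *\<^sub>R v \<noteq> 0"
    then have z: "z \<bullet> z > 0" by (simp add: z_def)
    define c where "c = z \<bullet> (X *v z) - l * (z \<bullet> z)"
    have quad: "0 \<le> 2 * t * (z \<bullet> z) + t\<^sup>2 * c" for t
    proof -
      have "0 \<le> (v + t *\<^sub>R z) \<bullet> (X *v (v + t *\<^sub>R z)) - l * ((v + t *\<^sub>R z) \<bullet> (v + t *\<^sub>R z))"
        using min by simp
      also have "\<dots> = (l - l * (v \<bullet> v)) + t * (2 * (z \<bullet> (X *v v)) - 2 * l * (z \<bullet> v)) + t\<^sup>2 * c"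
        using inner_symmetric_matrix[OF sym, of v z]
        by (simp add: matrix_vector_right_distrib matrix_vector_mult_scaleR inner_add_left
            inner_add_right l_def[symmetric] c_def power2_eq_square algebra_simps inner_commute)
      also have "2 * (z \<bullet> (X *v v)) - 2 * l * (z \<bullet> v) = 2 * (z \<bullet> z)"
        by (simp add: z_def inner_diff_right)
      finally show ?thesis by (simp add: vv algebra_simps)
    qed
    \<comment> \<open>With this t, t^2 (|c| + 1) = - t |z|^2, so the quadratic term consumes only
      half of the negative linear term. The + 1 keeps the denominator positive.\<close>
    define t where "t = - (z \<bullet> z) / (\<bar>c\<bar> + 1)"
    have "2 * t * (z \<bullet> z) + t\<^sup>2 * c \<le> 2 * t * (z \<bullet> z) + t\<^sup>2 * (\<bar>c\<bar> + 1)"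
      by (intro add_left_mono mult_left_mono) auto
    also have "\<dots> = t * (z \<bullet> z)"
    proof -
      have "t * (\<bar>c\<bar> + 1) = - (z \<bullet> z)"
        by (simp add: t_def)
      then have "t\<^sup>2 * (\<bar>c\<bar> + 1) = - (t * (z \<bullet> z))"
        by (simp only: power2_eq_square mult.assoc mult_minus_right)
      then show ?thesis by simp
    qed
    also have "\<dots> < 0"
      using z by (simp add: t_def mult_neg_pos divide_neg_pos)
    finally show False using quad[of t] by simp
  qed
  then show ?thesis
    using vv min by (intro that[of v l]) auto
qed

lemma lambda_min_le_form:
  fixes X :: "real ^ 'n ^ 'n::finite"
  assumes "transpose X = X"
  shows "lambda_min X * (w \<bullet> w) \<le> w \<bullet> (X *v w)"
proof -
  obtain l v where l: "v \<noteq> 0" "X *v v = l *\<^sub>R v" "l * (w \<bullet> w) \<le> w \<bullet> (X *v w)"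
    using symmetric_form_minimizer[OF assms] by metis
  then have "lambda_min X \<le> l"
    unfolding lambda_min_def by (intro Min_le finite_eigenvalues_symmetric assms) auto
  then have "lambda_min X * (w \<bullet> w) \<le> l * (w \<bullet> w)"
    by (intro mult_right_mono) auto
  also note l(3)
  finally show ?thesis .
qed

lemma le_lambda_min:
  fixes X :: "real ^ 'n ^ 'n::finite"
  assumes "transpose X = X" "\<And>w. c * (w \<bullet> w) \<le> w \<bullet> (X *v w)"
  shows "c \<le> lambda_min X"
  unfolding lambda_min_def
proof (rule Min.boundedI[OF finite_eigenvalues_symmetric[OF assms(1)]])
  obtain l' v' where "v' \<noteq> 0" "X *v v' = l' *\<^sub>R v'"
    by (rule symmetric_form_minimizer[OF assms(1)])
  then show "{l. \<exists>v. v \<noteq> 0 \<and> X *v v = l *\<^sub>R v} \<noteq> {}"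
    by auto
  fix l assume "l \<in> {l. \<exists>v. v \<noteq> 0 \<and> X *v v = l *\<^sub>R v}"
  then obtain v where v: "v \<noteq> 0" "X *v v = l *\<^sub>R v" by auto
  have "c * (v \<bullet> v) \<le> l * (v \<bullet> v)"
    using assms(2)[of v] by (simp only: v(2) inner_scaleR_right)
  then show "c \<le> l"
    by (rule mult_right_le_imp_le) (simp add: v(1))
qed

text \<open>Turns the eigenvalue and matrix-order conditions into a lower bound for a sum of
  squares, the form in which excitation enters the descent over a block.\<close>

lemma excitation_from_lambda_min:
  fixes x w :: "nat \<Rightarrow> real ^ 'n::finite"
  assumes "c\<^sub>0 \<ge> 0"
    and lam: "c\<^sub>0 * lambda_min ((1 / real m) *\<^sub>R (\<Sum>i\<in>J. outer (w i))) \<le> lambda_min (\<Sum>i\<in>I. outer (x i))"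
    and psd: "psd_le (\<delta>\<^sub>1 *\<^sub>R mat 1) ((1 / real m) *\<^sub>R (\<Sum>i\<in>J. outer (w i)))"
  shows "c\<^sub>0 * \<delta>\<^sub>1 * (norm v)\<^sup>2 \<le> (\<Sum>i\<in>I. (x i \<bullet> v)\<^sup>2)"
proof -
  let ?W = "(1 / real m) *\<^sub>R (\<Sum>i\<in>J. outer (w i))"
  have "\<delta>\<^sub>1 \<le> lambda_min ?W"
  proof (rule le_lambda_min)
    show "transpose ?W = ?W"
      using transpose_sum_outer[of w J] by (simp add: transpose_def vec_eq_iff)
    fix v :: "real ^ 'n"
    have "(?W - \<delta>\<^sub>1 *\<^sub>R mat 1) *v v = ?W *v v - \<delta>\<^sub>1 *\<^sub>R v"
      by (simp add: matrix_vector_mult_diff_rdistrib scaleR_matrix_vector_assoc[symmetric])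
    then show "\<delta>\<^sub>1 * (v \<bullet> v) \<le> v \<bullet> (?W *v v)"
      using psd unfolding psd_le_def by (metis diff_ge_0_iff_ge inner_diff_right inner_scaleR_right)
  qed
  then have "c\<^sub>0 * \<delta>\<^sub>1 \<le> lambda_min (\<Sum>i\<in>I. outer (x i))"
    using lam mult_left_mono[OF _ \<open>c\<^sub>0 \<ge> 0\<close>] order.trans by blast
  then have "c\<^sub>0 * \<delta>\<^sub>1 * (v \<bullet> v) \<le> lambda_min (\<Sum>i\<in>I. outer (x i)) * (v \<bullet> v)"
    by (intro mult_right_mono) auto
  also have "\<dots> \<le> (\<Sum>i\<in>I. (x i \<bullet> v)\<^sup>2)"
    using lambda_min_le_form[OF transpose_sum_outer, of x I v] by (simp add: inner_sum_outer_mult)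
  finally show ?thesis by (simp add: power2_norm_eq_inner)
qed

section \<open>Real recursions\<close>

text \<open>A strict contraction forgets its past geometrically, so t inherits the rate 1 / k of the
  perturbation. K is fixed before t, because t will depend on the noise realization.\<close>

lemma perturbed_contraction_rate:
  fixes q b c :: real
  assumes "0 \<le> q" "q < 1" "0 \<le> b" "0 \<le> c"
  obtains K where "K \<ge> 0"
    "\<And>t :: nat \<Rightarrow> real. \<lbrakk>t 1 \<le> b; \<And>k. k \<ge> 1 \<Longrightarrow> t (Suc k) \<le> q * t k + c / real (Suc k)\<rbrakk>
        \<Longrightarrow> \<forall>k\<ge>1. t k \<le> K / real k"
proof -
  \<comment> \<open>From k0 on, k (1 - q) >= 2, which lets the induction on K / k close. Up to k0 a
    crude linear bound is enough.\<close>
  obtain k0 :: nat where k0: "real k0 \<ge> 2 / (1 - q)"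
    using real_arch_simple by blast
  have k01: "k0 \<ge> 1"
    using k0 assms by (cases k0) (auto simp: field_simps)
  define K where "K = max (2 * c / (1 - q)) (real k0 * (b + c * real k0))"
  have K0: "K \<ge> 0" using assms by (simp add: K_def le_max_iff_disj)
  show ?thesis
  proof (rule that[OF K0], intro allI impI)
    fix t :: "nat \<Rightarrow> real" and k :: nat
    assume t1: "t 1 \<le> b" and t: "\<And>k. k \<ge> 1 \<Longrightarrow> t (Suc k) \<le> q * t k + c / real (Suc k)"
    assume "k \<ge> 1"
    have crude: "t k \<le> b + c * real k" if "k \<ge> 1" for k
      using that
    proof (induction k rule: dec_induct)
      case base
      then show ?case using t1 assms by simp
    next
      case (step k)
      \<comment> \<open>The sign of t is not known, and for negative values q * t k exceeds t
        k.\<close>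
      have "q * t k \<le> b + c * real k"
      proof (cases "t k \<le> 0")
        case True
        then have "q * t k \<le> 0" using assms by (simp add: mult_nonneg_nonpos)
        then show ?thesis using assms by (smt (verit) mult_nonneg_nonneg of_nat_0_le_iff)
      next
        case False
        then have "q * t k \<le> 1 * t k" using assms by (intro mult_right_mono) auto
        then show ?thesis using step by simp
      qed
      moreover have "c / real (Suc k) \<le> c"
        using assms by (simp add: divide_le_eq mult_le_cancel_left1)
      ultimately show ?case using t[of k] step by (simp add: algebra_simps)
    qed
    show "t k \<le> K / real k"
    proof (cases "k \<le> k0")
      case True
      have "t k * real k \<le> (b + c * real k) * real k"
        using crude \<open>k \<ge> 1\<close> by (intro mult_right_mono) auto
      also have "\<dots> \<le> (b + c * real k0) * real k0"
        using True assms by (intro mult_mono add_mono) auto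
      also have "\<dots> \<le> K" by (simp add: K_def mult.commute)
      finally show ?thesis using \<open>k \<ge> 1\<close> by (simp add: field_simps)
    next
      case False
      then have "k0 \<le> k" by simp
      then show ?thesis
      proof (induction k rule: dec_induct)
        case base
        have "t k0 * real k0 \<le> (b + c * real k0) * real k0"
          using crude k01 by (intro mult_right_mono) auto
        also have "\<dots> \<le> K" by (simp add: K_def mult.commute)
        finally show ?case using k01 by (simp add: field_simps)
      next
        case (step k)
        have k: "k \<ge> 1" "real k \<ge> 2 / (1 - q)" using step k01 k0 by auto
        have kq: "2 \<le> real k * (1 - q)" using k assms by (simp add: field_simps)
        have "2 * c / (1 - q) \<le> K"
          by (simp add: K_def)
        then have cK: "2 * c \<le> K * (1 - q)"
          using assms by (simp only: pos_divide_le_eq diff_gt_0_iff_gt)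
        \<comment> \<open>Half of K k (1 - q) pays for q K by the choice of k0, the other half for c
          k by the choice of K.\<close>
        have "q * K * (real k + 1) + c * real k \<le> K * real k"
        proof -
          have "2 * q * K \<le> 2 * K" using K0 assms by (simp add: mult_left_le_one_le)
          also have "\<dots> \<le> real k * (1 - q) * K" using kq K0 by (intro mult_right_mono) auto
          finally have "2 * (q * K) \<le> real k * (1 - q) * K" by simp
          moreover have "2 * c * real k \<le> K * (1 - q) * real k" using cK by (intro mult_right_mono) auto
          ultimately show ?thesis by (simp add: algebra_simps)
        qed
        then have "(q * K * (real k + 1) + c * real k) / (real k * (real k + 1))
            \<le> K * real k / (real k * (real k + 1))"
          by (intro divide_right_mono) auto
        then have "q * (K / real k) + c / real (Suc k) \<le> K / real (Suc k)"
          using k by (simp add: add_divide_distrib add.commute)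
        moreover have "q * t k \<le> q * (K / real k)"
          using step assms by (intro mult_left_mono) auto
        ultimately show ?case using t[of k] k by linarith
      qed
    qed
  qed
qed

text \<open>Chung's lemma for step sizes 1 / n. Passing from L / n to L / (n + 1) requires a
  decrease of L / (n (n + 1)), while the recursion supplies \<alpha> times that amount; the surplus
  (\<alpha> - 1) L absorbs K.\<close>

lemma chung_rate:
  fixes x :: "nat \<Rightarrow> real"
  assumes "\<alpha> > 1" "K \<ge> 0" "\<And>n. x n \<ge> 0"
    and x: "\<And>n. n \<ge> 1 \<Longrightarrow> x (Suc n) \<le> (1 - \<alpha> / real (Suc n)) * x n + K / (real n)\<^sup>2"
  obtains L n0 where "L \<ge> 0" "n0 \<ge> 1" "\<And>n. n \<ge> n0 \<Longrightarrow> x n \<le> L / real n"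
proof -
  \<comment> \<open>Past \<alpha> the factor 1 - \<alpha> / (n + 1) is nonnegative, so an upper
    bound on x n may be inserted into the recursion.\<close>
  obtain n0 :: nat where n0: "real n0 \<ge> \<alpha>"
    using real_arch_simple by blast
  have n01: "n0 \<ge> 1" using n0 assms by (cases n0) auto
  \<comment> \<open>The first entry starts the induction at n0, the second yields 2 K <= (\<alpha> -
    1) L; the 2 accounts for n + 1 <= 2 n.\<close>
  define L where "L = max (real n0 * x n0) (2 * K / (\<alpha> - 1))"
  have L0: "L \<ge> 0" using assms by (simp add: L_def le_max_iff_disj)
  have "2 * K / (\<alpha> - 1) \<le> L"
    by (simp add: L_def)
  then have L2: "2 * K \<le> (\<alpha> - 1) * L"
    using assms(1) by (simp only: pos_divide_le_eq diff_gt_0_iff_gt mult.commute)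
  have "x n \<le> L / real n" if "n \<ge> n0" for n
    using that
  proof (induction n rule: dec_induct)
    case base
    then show ?case using n01 by (simp add: L_def field_simps)
  next
    case (step n)
    have n: "n \<ge> 1" "real n > 0" "\<alpha> \<le> real (Suc n)" using step n01 n0 by auto
    have "x (Suc n) \<le> (1 - \<alpha> / real (Suc n)) * (L / real n) + K / (real n)\<^sup>2"
    proof (rule order.trans[OF x[OF n(1)]])
      have "0 \<le> 1 - \<alpha> / real (Suc n)"
        using n(3) by (simp only: le_diff_eq add_0 pos_divide_le_eq of_nat_0_less_iff zero_less_Suc mult_1)
      then show "(1 - \<alpha> / real (Suc n)) * x n + K / (real n)\<^sup>2
          \<le> (1 - \<alpha> / real (Suc n)) * (L / real n) + K / (real n)\<^sup>2"
        using step by (intro add_right_mono mult_left_mono) auto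
    qed
    also have "\<dots> \<le> L / real (Suc n)"
    proof -
      have "K * (real n + 1) \<le> 2 * K * real n"
        using n assms by (simp add: algebra_simps mult_le_cancel_left1)
      also have "\<dots> \<le> (\<alpha> - 1) * L * real n"
        using L2 by (intro mult_right_mono) auto
      finally have "K * (real n + 1) \<le> (\<alpha> - 1) * L * real n" .
      then have nonneg: "0 \<le> ((\<alpha> - 1) * L * real n - K * (real n + 1)) / ((real n)\<^sup>2 * (real n + 1))"
        by (intro divide_nonneg_nonneg) auto
      have "((\<alpha> - 1) * L * t - K * (t + 1)) / (t\<^sup>2 * (t + 1))
          = L / (t + 1) - ((1 - \<alpha> / (t + 1)) * (L / t) + K / t\<^sup>2)" if "t > 0" for t
        using that by (simp add: divide_simps power2_eq_square) (simp add: algebra_simps)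
      from nonneg this[OF n(2)] have "0 \<le> L / (real n + 1)
          - ((1 - \<alpha> / (real n + 1)) * (L / real n) + K / (real n)\<^sup>2)"
        by (simp only:)
      then show ?thesis
        by (simp add: add.commute)
    qed
    finally show ?case .
  qed
  with L0 n01 show ?thesis using that by blast
qed

text \<open>Sampling at multiples of N gives Chung's recursion, as \<alpha> N / (n N + 1) >=
  \<alpha> / (n + 1). Between samples there are fewer than N steps, each adding O(1 / n), so the
  rate survives.\<close>

lemma block_recursion_rate:
  fixes r :: "nat \<Rightarrow> real"
  assumes r0: "\<And>k. r k \<ge> 0" and "\<alpha> > 1" "N > 0" "K \<ge> 0"
    and block: "\<And>k. k \<ge> 1 \<Longrightarrow> r (k + N) \<le> (1 - \<alpha> * real N / real (Suc k)) * r k + K / (real (Suc k))\<^sup>2"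
    and step: "\<And>k. k \<ge> 1 \<Longrightarrow> r (Suc k) \<le> r k + K / real (Suc k)"
  shows "r \<in> O(\<lambda>k. 1 / real k)"
proof -
  have x: "r (Suc n * N) \<le> (1 - \<alpha> / real (Suc n)) * r (n * N) + K / (real n)\<^sup>2" if "n \<ge> 1" for n
  proof -
    have nN: "n * N \<ge> 1" "n \<le> n * N" using that \<open>N > 0\<close> by auto
    have "r (Suc n * N) \<le> (1 - \<alpha> * real N / real (Suc (n * N))) * r (n * N) + K / (real (Suc (n * N)))\<^sup>2"
      using block[OF nN(1)] by (simp add: add.commute)
    also have "\<dots> \<le> (1 - \<alpha> / real (Suc n)) * r (n * N) + K / (real n)\<^sup>2"
    proof (intro add_mono mult_right_mono r0)
      have "real (Suc (n * N)) \<le> real N * real (Suc n)"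
        using \<open>N > 0\<close> by (simp add: algebra_simps)
      then have "\<alpha> * real (Suc (n * N)) \<le> \<alpha> * (real N * real (Suc n))"
        using \<open>\<alpha> > 1\<close> by (intro mult_left_mono) auto
      then have "\<alpha> / real (Suc n) \<le> \<alpha> * real N / real (Suc (n * N))"
        by (simp add: pos_le_divide_eq pos_divide_le_eq mult_ac del: of_nat_Suc)
      then show "1 - \<alpha> * real N / real (Suc (n * N)) \<le> 1 - \<alpha> / real (Suc n)" by simp
      show "K / (real (Suc (n * N)))\<^sup>2 \<le> K / (real n)\<^sup>2"
        using that nN \<open>K \<ge> 0\<close>
        by (intro divide_left_mono power_mono mult_pos_pos zero_less_power of_nat_mono le_SucI)
            (auto simp del: of_nat_Suc simp: of_nat_0_less_iff)
    qed
    finally show ?thesis .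
  qed
  obtain L n0 where L: "L \<ge> 0" "n0 \<ge> 1" "\<And>n. n \<ge> n0 \<Longrightarrow> r (n * N) \<le> L / real n"
    using chung_rate[of \<alpha> K "\<lambda>n. r (n * N)"] x assms by metis
  have steps: "r (k + j) \<le> r k + real j * (K / real k)" if "k \<ge> 1" for k j
  proof (induction j)
    case (Suc j)
    have "K / real (Suc (k + j)) \<le> K / real k"
      using that \<open>K \<ge> 0\<close> by (intro divide_left_mono mult_pos_pos) auto
    moreover have "real (Suc j) * (K / real k) = real j * (K / real k) + K / real k"
      by (simp only: of_nat_Suc distrib_right mult_1)
    moreover have "r (k + Suc j) \<le> r (k + j) + K / real (Suc (k + j))"
      using step[of "k + j"] that by simp
    ultimately show ?case
      using Suc by linarith
  qed simp
  have "r k \<le> (2 * real N * (L + real N * K)) * (1 / real k)" if k: "k \<ge> N * n0" "k \<ge> 1" for k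
  proof -
    define n where "n = k div N"
    have n: "n \<ge> n0" "n \<ge> 1"
      using div_le_mono[OF k(1), of N] \<open>N > 0\<close> \<open>n0 \<ge> 1\<close> by (auto simp: n_def)
    have kn: "k = n * N + k mod N" "k mod N < N"
      using \<open>N > 0\<close> by (auto simp: n_def)
    have "r k \<le> r (n * N) + real (k mod N) * (K / real (n * N))"
      using steps[of "n * N" "k mod N"] n \<open>N > 0\<close> kn by simp
    also have "\<dots> \<le> L / real n + real N * (K / real n)"
      using L(3)[OF n(1)] kn n \<open>N > 0\<close> \<open>K \<ge> 0\<close>
      by (intro add_mono mult_mono divide_left_mono mult_pos_pos) auto
    also have "\<dots> = (L + real N * K) * (1 / real n)"
      by (simp add: add_divide_distrib)
    also have "\<dots> \<le> (L + real N * K) * (2 * real N / real k)"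
    proof (intro mult_left_mono)
      have "k \<le> n * N + N" using kn by linarith
      also have "\<dots> \<le> 2 * N * n" using n \<open>N > 0\<close> by (simp add: algebra_simps)
      finally have "real k \<le> 2 * real N * real n"
        by (metis of_nat_le_iff of_nat_mult of_nat_numeral)
      then show "1 / real n \<le> 2 * real N / real k"
        using n k by (simp add: field_simps)
    qed (use L \<open>K \<ge> 0\<close> in auto)
    finally show ?thesis by (simp add: mult_ac)
  qed
  then have "eventually (\<lambda>k. norm (r k) \<le> (2 * real N * (L + real N * K)) * norm (1 / real k)) at_top"
    using r0 by (intro eventually_at_top_linorderI[of "max 1 (N * n0)"]) auto
  then show ?thesis by (rule bigoI)
qed

section \<open>Drift of the estimation error\<close>

lemma inner_sum_type:
  fixes v w :: "real ^ ('p::finite + 'q::finite)"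
  shows "v \<bullet> w = ar_part v \<bullet> ar_part w + input_part v \<bullet> input_part w"
proof -
  have "v \<bullet> w = (\<Sum>r\<in>UNIV <+> UNIV. v $ r * w $ r)"
    by (simp add: inner_vec_def)
  also have "\<dots> = ar_part v \<bullet> ar_part w + input_part v \<bullet> input_part w"
    by (subst sum.Plus) (simp_all add: inner_vec_def ar_part_def input_part_def)
  finally show ?thesis .
qed

text \<open>The constant \<open>K\<close> depends only on the bounds, not on the trajectory, so that the estimate is
  uniform over the noise realizations. The proof subtracts the quasi-static response
  \<open>r k / (1 - h)\<close> from the convolution of \<open>r\<close> with the powers of \<open>h\<close>.\<close>

lemma driven_state_bound:
  fixes A :: "real ^ 'n::finite ^ 'n" and b :: "real ^ 'n"
  assumes A: "\<And>k v. norm (((*v) A ^^ k) v) \<le> M * h ^ k * norm v"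
    and h: "0 \<le> h" "h < 1" and "M \<ge> 0" "norm b \<le> 1" "M\<^sub>2 > 0" "R \<ge> 0" "c \<ge> 0"
  obtains K where "K \<ge> 0"
    "\<And>X w r. \<lbrakk>X 0 = x\<^sub>0; \<And>k. X (Suc k) = A *v X k + w (Suc k) *\<^sub>R b;
        \<And>k. k \<ge> 1 \<Longrightarrow> \<bar>w k\<bar> \<le> M\<^sub>2 * r k; \<And>k. k \<ge> 1 \<Longrightarrow> \<bar>r (Suc k) - r k\<bar> \<le> c / real (Suc k);
        0 \<le> r 1; r 1 \<le> R\<rbrakk> \<Longrightarrow> \<forall>k\<ge>1. norm (X k) \<le> M * M\<^sub>2 / (1 - h) * r k + K / real k"
proof -
  \<comment> \<open>Subtracting r k / (1 - h) from the convolution leaves h / (1 - h) times the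
    increment of r as perturbation, hence this constant.\<close>
  define c' where "c' = h / (1 - h) * c"
  obtain K where K: "K \<ge> 0"
    "\<And>t :: nat \<Rightarrow> real. \<lbrakk>t 1 \<le> h * norm x\<^sub>0 / M\<^sub>2 + R; \<And>k. k \<ge> 1 \<Longrightarrow> t (Suc k) \<le> h * t k + c' / real (Suc k)\<rbrakk>
        \<Longrightarrow> \<forall>k\<ge>1. t k \<le> K / real k"
    using perturbed_contraction_rate[of h "h * norm x\<^sub>0 / M\<^sub>2 + R" c'] assms
    by (auto simp: c'_def)
  show ?thesis
  proof (rule that[of "M * M\<^sub>2 * K"], goal_cases)
    case 1
    show ?case using assms K by simp
  next
    case (2 X w r)
    have X: "X k = ((*v) A ^^ k) x\<^sub>0 + (\<Sum>i<k. ((*v) A ^^ i) (w (k - i) *\<^sub>R b))" for k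
    proof (induction k)
      case (Suc k)
      have sum: "A *v (\<Sum>i<k. g i) = (\<Sum>i<k. A *v g i)" for g
        by (induction k) (auto simp: matrix_vector_right_distrib)
      show ?case
        unfolding 2(2) Suc
        by (simp add: sum.lessThan_Suc_shift matrix_vector_right_distrib sum del: sum.lessThan_Suc)
    qed (simp add: 2)
    \<comment> \<open>S is the scalar majorant of the state, with powers of h in place of powers of
      A. Dividing the initial norm by \<open>M\<^sub>2\<close> lets \<open>M * M\<^sub>2\<close> be
      pulled out of both summands.\<close>
    define S where "S k = h ^ k * (norm x\<^sub>0 / M\<^sub>2) + (\<Sum>i<k. h ^ i * r (k - i))" for k
    have S_Suc: "S (Suc k) = h * S k + r (Suc k)" for k
      by (simp add: S_def sum.lessThan_Suc_shift distrib_left sum_distrib_left mult.assoc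
          del: sum.lessThan_Suc)
    have XS: "norm (X k) \<le> M * M\<^sub>2 * S k" for k
    proof -
      have "norm (X k) \<le> norm (((*v) A ^^ k) x\<^sub>0) + (\<Sum>i<k. norm (((*v) A ^^ i) (w (k - i) *\<^sub>R b)))"
        unfolding X by (intro order.trans[OF norm_triangle_ineq] add_left_mono norm_sum)
      also have "\<dots> \<le> M * h ^ k * norm x\<^sub>0 + (\<Sum>i<k. M * h ^ i * (M\<^sub>2 * r (k - i)))"
      proof (intro add_mono sum_mono A order.trans[OF A mult_left_mono])
        fix i assume "i \<in> {..<k}"
        then have "\<bar>w (k - i)\<bar> * norm b \<le> M\<^sub>2 * r (k - i) * 1"
          using assms 2(3)[of "k - i"] by (intro mult_mono order.trans[OF abs_ge_zero 2(3)]) auto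
        then show "norm (w (k - i) *\<^sub>R b) \<le> M\<^sub>2 * r (k - i)" by simp
      qed (use assms in auto)
      also have "\<dots> = M * M\<^sub>2 * S k"
        using assms by (simp add: S_def distrib_left sum_distrib_left mult_ac)
      finally show ?thesis .
    qed
    define t where "t k = S k - r k / (1 - h)" for k
    have "\<forall>k\<ge>1. t k \<le> K / real k"
    proof (rule K(2))
      have "r 1 \<le> r 1 / (1 - h)"
        using 2 h by (simp add: field_simps mult_left_le)
      moreover have "S 1 = h * norm x\<^sub>0 / M\<^sub>2 + r 1"
        by (simp add: S_def)
      ultimately show "t 1 \<le> h * norm x\<^sub>0 / M\<^sub>2 + R"
        using 2 assms by (simp add: t_def)
      fix k :: nat assume "k \<ge> 1"
      have "t (Suc k) = h * t k + h / (1 - h) * (r k - r (Suc k))"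
      proof -
        have "r (Suc k) - r (Suc k) / (1 - h) = - (h / (1 - h) * r (Suc k))"
          using h by (simp add: field_simps)
        then show ?thesis
          by (simp add: t_def S_Suc algebra_simps)
      qed
      also have "\<dots> \<le> h * t k + h / (1 - h) * (c / real (Suc k))"
        using 2(4)[OF \<open>k \<ge> 1\<close>] h by (intro add_left_mono mult_left_mono) auto
      finally show "t (Suc k) \<le> h * t k + c' / real (Suc k)"
        by (simp add: c'_def)
    qed
    then have "S k \<le> r k / (1 - h) + K / real k" if "k \<ge> 1" for k
      using that by (simp add: t_def algebra_simps)
    then have "M * M\<^sub>2 * S k \<le> M * M\<^sub>2 * (r k / (1 - h) + K / real k)" if "k \<ge> 1" for k
      using that assms by (intro mult_left_mono) auto
    then show ?case
      using order.trans[OF XS] by (simp add: distrib_left)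
  qed
qed

text \<open>Projection is nonexpansive and fixes v. With v the true parameter this removes the
  projection from the error recursion; with v the previous estimate it bounds the length of a
  step.\<close>

lemma norm_closest_point_diff_le:
  fixes \<Theta> :: "'a::euclidean_space set"
  assumes "convex \<Theta>" "closed \<Theta>" "v \<in> \<Theta>"
  shows "norm (closest_point \<Theta> x - v) \<le> norm (x - v)"
  using closest_point_lipschitz[of \<Theta> x v] closest_point_self[OF assms(3)] assms
  by (auto simp: dist_norm)

text \<open>The mean value theorem with no order between a and b. Measuring distances from c keeps
  the intermediate point in the interval where f is controlled.\<close>

lemma obtain_mean_value:
  fixes F f :: "real \<Rightarrow> real"
  assumes "\<And>x. (F has_real_derivative f x) (at x)" "\<bar>a - c\<bar> \<le> R" "\<bar>b - c\<bar> \<le> R"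
  obtains \<xi> where "\<bar>\<xi> - c\<bar> \<le> R" "F a - F b = f \<xi> * (a - b)"
proof -
  consider "a < b" | "b < a" | "a = b" by linarith
  then show ?thesis
  proof cases
    case 1
    then obtain \<xi> where "a < \<xi>" "\<xi> < b" "F b - F a = (b - a) * f \<xi>"
      using MVT2[of a b F f] assms by blast
    with assms show ?thesis by (intro that[of \<xi>]) (auto simp: algebra_simps)
  next
    case 2
    then obtain \<xi> where "b < \<xi>" "\<xi> < a" "F a - F b = (a - b) * f \<xi>"
      using MVT2[of b a F f] assms by blast
    with assms show ?thesis by (intro that[of \<xi>]) (auto simp: algebra_simps)
  next
    case 3
    with assms show ?thesis by (intro that[of a]) auto
  qed
qed

text \<open>With \<open>D = \<phi>' - \<phi>\<close>, the difference of the predictions is \<open>\<phi> \<bullet> e + D \<bullet> \<theta>'\<close>, and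
  \<open>(e \<bullet> \<phi>') (\<phi> \<bullet> e + D \<bullet> \<theta>') = (\<phi> \<bullet> e)\<^sup>2 + (D \<bullet> e) (\<phi> \<bullet> e) + (e \<bullet> \<phi>') (D \<bullet> \<theta>')\<close>. Only the
  autoregressive block of \<open>D\<close> is nonzero, so that \<open>\<theta>'\<close> and \<open>e\<close> enter the last two terms only through
  their autoregressive blocks.\<close>

lemma expected_update_le:
  fixes \<phi> \<phi>' \<theta> \<theta>' :: "real ^ ('p::finite + 'q::finite)"
  assumes F: "\<And>x. (F has_real_derivative f x) (at x)"
    and f: "\<And>x. 0 \<le> f x" "\<And>x. \<bar>x - C\<bar> \<le> R \<Longrightarrow> f\<^sub>m \<le> f x \<and> f x \<le> f\<^sub>M"
    and R: "\<bar>\<phi> \<bullet> \<theta>\<bar> \<le> R" "\<bar>\<phi>' \<bullet> \<theta>'\<bar> \<le> R"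
    and D: "input_part \<phi>' = input_part \<phi>"
    and g: "norm (ar_part \<theta>) \<le> g" "norm (ar_part \<theta>') \<le> g"
    and M: "norm \<phi> \<le> M\<^sub>1" "norm \<phi>' \<le> M\<^sub>2"
  shows "((\<theta>' - \<theta>) \<bullet> \<phi>') * (F (C - \<phi>' \<bullet> \<theta>') - F (C - \<phi> \<bullet> \<theta>))
    \<le> - f\<^sub>m * (\<phi> \<bullet> (\<theta>' - \<theta>))\<^sup>2
       + f\<^sub>M * g * (M\<^sub>2 + 2 * M\<^sub>1) * (norm (\<theta>' - \<theta>) * norm (ar_part \<phi>' - ar_part \<phi>))"
proof -
  define e D X where "e = \<theta>' - \<theta>" and "D = \<phi>' - \<phi>" and "X = ar_part \<phi>' - ar_part \<phi>"
  have "ar_part D = X" "input_part D = 0"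
    using D by (auto simp: D_def X_def ar_part_def input_part_def vec_eq_iff)
  then have inner_D: "D \<bullet> v = X \<bullet> ar_part v" for v
    by (simp add: inner_sum_type)
  have g0: "0 \<le> g"
    using g norm_ge_zero order.trans by blast
  have D\<theta>': "\<bar>D \<bullet> \<theta>'\<bar> \<le> g * norm X"
    unfolding inner_D using g
    by (intro order.trans[OF Cauchy_Schwarz_ineq2]) (simp add: mult.commute[of g] mult_left_mono)
  \<comment> \<open>The autoregressive blocks of both parameters are bounded by g, so their
    difference e costs 2 g; this is the origin of the 2 in
    \<open>M\<^sub>2 + 2 * M\<^sub>1\<close>.\<close>
  have "\<bar>D \<bullet> e\<bar> \<le> \<bar>D \<bullet> \<theta>'\<bar> + \<bar>D \<bullet> \<theta>\<bar>"
    by (simp add: e_def inner_diff_right)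
  moreover have "\<bar>D \<bullet> \<theta>\<bar> \<le> g * norm X"
    unfolding inner_D using g
    by (intro order.trans[OF Cauchy_Schwarz_ineq2]) (simp add: mult.commute[of g] mult_left_mono)
  ultimately have De: "\<bar>D \<bullet> e\<bar> \<le> 2 * (g * norm X)"
    using D\<theta>' by simp
  have \<phi>e: "\<bar>\<phi> \<bullet> e\<bar> \<le> M\<^sub>1 * norm e" and e\<phi>': "\<bar>e \<bullet> \<phi>'\<bar> \<le> M\<^sub>2 * norm e"
    using M by (auto intro!: order.trans[OF Cauchy_Schwarz_ineq2] mult_right_mono
        simp: mult.commute[of "norm e"])
  obtain \<xi> where \<xi>: "\<bar>\<xi> - C\<bar> \<le> R"
    "F (C - \<phi>' \<bullet> \<theta>') - F (C - \<phi> \<bullet> \<theta>) = f \<xi> * ((C - \<phi>' \<bullet> \<theta>') - (C - \<phi> \<bullet> \<theta>))"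
    using obtain_mean_value[OF F, of "C - \<phi>' \<bullet> \<theta>'" C R "C - \<phi> \<bullet> \<theta>"] R by auto
  have diff: "(C - \<phi>' \<bullet> \<theta>') - (C - \<phi> \<bullet> \<theta>) = - (\<phi> \<bullet> e + D \<bullet> \<theta>')"
    by (simp add: e_def D_def inner_diff_left inner_diff_right)
  have "e \<bullet> \<phi>' = \<phi> \<bullet> e + D \<bullet> e"
    by (simp add: D_def inner_diff_left inner_commute[of e])
  then have prod: "(e \<bullet> \<phi>') * (\<phi> \<bullet> e + D \<bullet> \<theta>') = (\<phi> \<bullet> e)\<^sup>2 + ((D \<bullet> e) * (\<phi> \<bullet> e) + (e \<bullet> \<phi>') * (D \<bullet> \<theta>'))"
    by (simp add: power2_eq_square algebra_simps)
  have "(e \<bullet> \<phi>') * (F (C - \<phi>' \<bullet> \<theta>') - F (C - \<phi> \<bullet> \<theta>))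
      = - f \<xi> * (\<phi> \<bullet> e)\<^sup>2 + f \<xi> * - ((D \<bullet> e) * (\<phi> \<bullet> e) + (e \<bullet> \<phi>') * (D \<bullet> \<theta>'))"
  proof -
    have "(e \<bullet> \<phi>') * (F (C - \<phi>' \<bullet> \<theta>') - F (C - \<phi> \<bullet> \<theta>))
        = - f \<xi> * ((e \<bullet> \<phi>') * (\<phi> \<bullet> e + D \<bullet> \<theta>'))"
      by (simp only: \<xi>(2) diff mult_minus_left mult_minus_right mult_ac)
    then show ?thesis
      by (simp only: prod) (simp add: algebra_simps)
  qed
  also have "\<dots> \<le> - f\<^sub>m * (\<phi> \<bullet> e)\<^sup>2 + f\<^sub>M * (2 * (g * norm X) * (M\<^sub>1 * norm e) + M\<^sub>2 * norm e * (g * norm X))"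
  proof (rule add_mono)
    show "- f \<xi> * (\<phi> \<bullet> e)\<^sup>2 \<le> - f\<^sub>m * (\<phi> \<bullet> e)\<^sup>2"
      using f(2)[OF \<xi>(1)] by (intro mult_right_mono) auto
    have "\<bar>(D \<bullet> e) * (\<phi> \<bullet> e)\<bar> \<le> 2 * (g * norm X) * (M\<^sub>1 * norm e)"
      unfolding abs_mult using De \<phi>e g0 by (intro mult_mono) auto
    moreover have "\<bar>(e \<bullet> \<phi>') * (D \<bullet> \<theta>')\<bar> \<le> M\<^sub>2 * norm e * (g * norm X)"
      unfolding abs_mult using D\<theta>' e\<phi>' by (intro mult_mono order.trans[OF abs_ge_zero e\<phi>']) auto
    ultimately have le: "- ((D \<bullet> e) * (\<phi> \<bullet> e) + (e \<bullet> \<phi>') * (D \<bullet> \<theta>'))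
        \<le> 2 * (g * norm X) * (M\<^sub>1 * norm e) + M\<^sub>2 * norm e * (g * norm X)" (is "?l \<le> ?r")
      and r0: "0 \<le> 2 * (g * norm X) * (M\<^sub>1 * norm e) + M\<^sub>2 * norm e * (g * norm X)"
      by linarith+
    \<comment> \<open>\<open>?l\<close> has no definite sign, so f is bounded by its maximum only
      after \<open>?l\<close> has been replaced by the nonnegative \<open>?r\<close>.\<close>
    have "f \<xi> * ?l \<le> f \<xi> * ?r"
      using le f(1) by (rule mult_left_mono)
    also have "\<dots> \<le> f\<^sub>M * ?r"
      using f(2)[OF \<xi>(1)] r0 by (intro mult_right_mono) auto
    finally show "f \<xi> * ?l \<le> f\<^sub>M * ?r" .
  qed
  also have "\<dots> = - f\<^sub>m * (\<phi> \<bullet> e)\<^sup>2 + f\<^sub>M * g * (M\<^sub>2 + 2 * M\<^sub>1) * (norm e * norm X)"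
    by (simp add: algebra_simps)
  finally show ?thesis
    by (simp add: e_def X_def)
qed

text \<open>Both squares factor as difference times sum, so replacing e by a nearby e' costs a
  multiple of their distance. This permits evaluating the drift at the start of a block.\<close>

lemma quadratic_drift_perturbation:
  fixes e e' \<phi> :: "'a::real_inner"
  assumes "norm e \<le> R" "norm e' \<le> R" "norm (e - e') \<le> \<eta>" "norm \<phi> \<le> M" "0 \<le> a" "0 \<le> G"
  shows "- a * (\<phi> \<bullet> e)\<^sup>2 + G * (norm e)\<^sup>2
    \<le> - a * (\<phi> \<bullet> e')\<^sup>2 + G * (norm e')\<^sup>2 + (a * M\<^sup>2 + G) * (2 * R * \<eta>)"
proof -
  have R0: "0 \<le> R" and \<eta>0: "0 \<le> \<eta>" and M0: "0 \<le> M"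
    using assms norm_ge_zero order.trans by metis+
  have sum: "norm (e + e') \<le> 2 * R"
    using norm_triangle_ineq[of e e'] assms by linarith
  have "\<bar>(\<phi> \<bullet> e)\<^sup>2 - (\<phi> \<bullet> e')\<^sup>2\<bar> = \<bar>\<phi> \<bullet> (e - e')\<bar> * \<bar>\<phi> \<bullet> (e + e')\<bar>"
    by (simp add: inner_diff_right inner_add_right power2_eq_square algebra_simps flip: abs_mult)
  also have "\<dots> \<le> (M * \<eta>) * (M * (2 * R))"
    using assms sum R0 \<eta>0 M0
    by (intro mult_mono order.trans[OF Cauchy_Schwarz_ineq2]) auto
  finally have 1: "\<bar>(\<phi> \<bullet> e)\<^sup>2 - (\<phi> \<bullet> e')\<^sup>2\<bar> \<le> M\<^sup>2 * (2 * R * \<eta>)"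
    by (simp add: power2_eq_square mult_ac)
  have "(norm e)\<^sup>2 - (norm e')\<^sup>2 = (e - e') \<bullet> (e + e')"
    by (simp add: power2_norm_eq_inner inner_diff_left inner_add_right inner_commute[of e' e])
  also have "\<dots> \<le> \<eta> * (2 * R)"
    using assms sum R0 \<eta>0 by (intro order.trans[OF norm_cauchy_schwarz] mult_mono) auto
  finally have 2: "(norm e)\<^sup>2 - (norm e')\<^sup>2 \<le> 2 * R * \<eta>"
    by (simp only: mult_ac)
  have "a * ((\<phi> \<bullet> e')\<^sup>2 - (\<phi> \<bullet> e)\<^sup>2) \<le> a * (M\<^sup>2 * (2 * R * \<eta>))"
    using 1 assms by (intro mult_left_mono) auto
  moreover have "G * ((norm e)\<^sup>2 - (norm e')\<^sup>2) \<le> G * (2 * R * \<eta>)"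
    using 2 assms by (intro mult_left_mono) auto
  ultimately show ?thesis by (simp add: algebra_simps)
qed

text \<open>Freezes the step size 1 / i of a block at 1 / (k + 1); since |1 / i - 1 / (k + 1)| <= N
  / (k + 1)^2, the cost is of second order.\<close>

lemma divide_shift_index_le:
  fixes Q q :: real
  assumes "\<bar>Q\<bar> \<le> q" "Suc k \<le> i" "i \<le> k + N"
  shows "Q / real i \<le> Q / real (Suc k) + q * real N / (real (Suc k))\<^sup>2"
proof -
  have pos: "real i > 0" "real (Suc k) > 0" using assms by auto
  have "\<bar>Q / real i - Q / real (Suc k)\<bar> = \<bar>Q\<bar> * (real i - real (Suc k)) / (real i * real (Suc k))"
  proof -
    have "Q / real i - Q / real (Suc k) = - (Q * (real i - real (Suc k)) / (real i * real (Suc k)))"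
      using pos by (simp add: divide_simps del: of_nat_Suc) (simp add: algebra_simps)
    moreover have "\<bar>real i - real (Suc k)\<bar> = real i - real (Suc k)"
      using assms by simp
    ultimately show ?thesis
      using pos by (simp only: abs_minus abs_divide abs_mult abs_of_nonneg of_nat_0_le_iff)
  qed
  also have "\<dots> \<le> q * real N / (real (Suc k) * real (Suc k))"
    using assms pos by (intro frac_le mult_mono mult_pos_pos) auto
  finally show ?thesis by (simp add: power2_eq_square)
qed

text \<open>One regressor controls the error in a single direction, hence the passage to blocks. The
  estimate is pathwise: K precedes the trajectory so that the inequality can be integrated, and the
  terms Z are carried along because they will cancel only in expectation.\<close>

lemma block_descent:
  fixes \<phi> :: "nat \<Rightarrow> 'a::real_inner"
  assumes const: "\<gamma> \<ge> 0" "a \<ge> 0" "G \<ge> 0" "R \<ge> 0" "c \<ge> 0" "c' \<ge> 0" "b \<ge> 0"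
    and \<phi>: "\<And>i. i \<ge> 1 \<Longrightarrow> norm (\<phi> i) \<le> M"
    and PE: "\<And>k w. k \<ge> 1 \<Longrightarrow> real N * \<delta> * (norm w)\<^sup>2 \<le> (\<Sum>i\<in>{k<..k + N}. (\<phi> i \<bullet> w)\<^sup>2)"
  obtains K where "K \<ge> 0"
    "\<And>e Z D k. \<lbrakk>\<And>i. i \<ge> 1 \<Longrightarrow> norm (e i) \<le> R;
        \<And>i. i \<ge> 1 \<Longrightarrow> norm (e (Suc i) - e i) \<le> c / real (Suc i);
        \<And>i. i \<ge> 1 \<Longrightarrow> (norm (e (Suc i)))\<^sup>2
          \<le> (norm (e i))\<^sup>2 + 2 * \<gamma> / real (Suc i) * (Z (Suc i) + D (Suc i)) + c' / (real (Suc i))\<^sup>2;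
        \<And>i. i \<ge> 1 \<Longrightarrow> D (Suc i) \<le> - a * (\<phi> (Suc i) \<bullet> e i)\<^sup>2 + G * (norm (e i))\<^sup>2 + b / real i; k \<ge> 1\<rbrakk>
      \<Longrightarrow> (norm (e (k + N)))\<^sup>2 \<le> (1 - 2 * \<gamma> * (a * \<delta> - G) * real N / real (Suc k)) * (norm (e k))\<^sup>2
          + (\<Sum>i\<in>{k<..k + N}. 2 * \<gamma> / real i * Z i) + K / (real (Suc k))\<^sup>2"
proof -
  define q where "q = a * (M * R)\<^sup>2 + G * R\<^sup>2"
  define K\<^sub>2 where "K\<^sub>2 = (a * M\<^sup>2 + G) * (2 * R * (real N * c)) + 2 * b"
  define K\<^sub>3 where "K\<^sub>3 = 2 * \<gamma> * (q * real N + K\<^sub>2) + c'"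
  have nn: "q \<ge> 0" "K\<^sub>2 \<ge> 0" "K\<^sub>3 \<ge> 0"
    using const by (auto simp: q_def K\<^sub>2_def K\<^sub>3_def)
  show ?thesis
  proof (rule that[of "real N * K\<^sub>3"], goal_cases)
    case 1
    show ?case using nn by simp
  next
    case (2 e Z D k)
    define Q where "Q i = - a * (\<phi> i \<bullet> e k)\<^sup>2 + G * (norm (e k))\<^sup>2" for i
    have dist: "norm (e (k + j) - e k) \<le> real j * (c / real (Suc k))" for j
    proof (induction j)
      case (Suc j)
      have "norm (e (k + Suc j) - e k) \<le> norm (e (Suc (k + j)) - e (k + j)) + norm (e (k + j) - e k)"
        using norm_triangle_ineq[of "e (Suc (k + j)) - e (k + j)" "e (k + j) - e k"] by simp
      also have "norm (e (Suc (k + j)) - e (k + j)) \<le> c / real (Suc (k + j))"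
        using 2(2)[of "k + j"] 2(5) by simp
      also have "\<dots> \<le> c / real (Suc k)"
        using const by (intro divide_left_mono mult_pos_pos) auto
      moreover have "real (Suc j) * (c / real (Suc k)) = real j * (c / real (Suc k)) + c / real (Suc k)"
        by (simp only: of_nat_Suc distrib_right mult_1)
      ultimately show ?case using Suc by linarith
    qed simp
    have step: "(norm (e (Suc i)))\<^sup>2 \<le> (norm (e i))\<^sup>2
        + (2 * \<gamma> / real (Suc i) * Z (Suc i) + 2 * \<gamma> / real (Suc k) * Q (Suc i) + K\<^sub>3 / (real (Suc k))\<^sup>2)"
      if i: "k \<le> i" "i < k + N" for i
    proof -
      have i1: "i \<ge> 1" using i 2(5) by simp
      have "D (Suc i) \<le> - a * (\<phi> (Suc i) \<bullet> e i)\<^sup>2 + G * (norm (e i))\<^sup>2 + b / real i"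
        using 2(4)[OF i1] .
      also have "- a * (\<phi> (Suc i) \<bullet> e i)\<^sup>2 + G * (norm (e i))\<^sup>2
          \<le> Q (Suc i) + (a * M\<^sup>2 + G) * (2 * R * (real N * (c / real (Suc k))))"
        unfolding Q_def
      proof (rule quadratic_drift_perturbation)
        have "norm (e i - e k) \<le> real (i - k) * (c / real (Suc k))"
          using dist[of "i - k"] i by simp
        also have "\<dots> \<le> real N * (c / real (Suc k))"
          using i const by (intro mult_right_mono) auto
        finally show "norm (e i - e k) \<le> real N * (c / real (Suc k))" .
      qed (use 2 i1 \<phi> const in auto)
      \<comment> \<open>From i >= k >= 1 follows k + 1 <= 2 i, the source of the 2 in
        \<open>K\<^sub>2\<close>.\<close>
      also have "b / real i \<le> 2 * b / real (Suc k)"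
      proof -
        have "b * real (Suc k) \<le> b * (2 * real i)"
          using i 2(5) const by (intro mult_left_mono) auto
        then show ?thesis
          using i1 by (simp add: pos_divide_le_eq pos_le_divide_eq mult_ac del: of_nat_Suc)
      qed
      finally have D: "D (Suc i) \<le> Q (Suc i) + K\<^sub>2 / real (Suc k)"
        by (simp add: K\<^sub>2_def add_divide_distrib del: of_nat_Suc)
      have "\<bar>Q (Suc i)\<bar> \<le> q"
      proof -
        have "\<bar>\<phi> (Suc i) \<bullet> e k\<bar> \<le> M * R"
          using \<phi>[of "Suc i"] 2(1)[OF 2(5)] const
          by (intro order.trans[OF Cauchy_Schwarz_ineq2] mult_mono order.trans[OF norm_ge_zero \<phi>[of "Suc i"]]) auto
        then have "(\<phi> (Suc i) \<bullet> e k)\<^sup>2 \<le> (M * R)\<^sup>2"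
          by (metis abs_ge_zero power2_abs power_mono)
        then have "a * (\<phi> (Suc i) \<bullet> e k)\<^sup>2 \<le> a * (M * R)\<^sup>2" "0 \<le> a * (\<phi> (Suc i) \<bullet> e k)\<^sup>2"
          using const by (auto intro: mult_left_mono)
        moreover have "G * (norm (e k))\<^sup>2 \<le> G * R\<^sup>2" "0 \<le> G * (norm (e k))\<^sup>2"
          using const 2(1)[OF 2(5)] by (auto intro!: mult_left_mono power_mono)
        ultimately show ?thesis by (simp add: Q_def q_def)
      qed
      then have Q: "Q (Suc i) / real (Suc i) \<le> Q (Suc i) / real (Suc k) + q * real N / (real (Suc k))\<^sup>2"
        using i by (intro divide_shift_index_le) auto
      have "D (Suc i) / real (Suc i) \<le> (Q (Suc i) + K\<^sub>2 / real (Suc k)) / real (Suc i)"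
        using D by (intro divide_right_mono) auto
      also have "\<dots> = Q (Suc i) / real (Suc i) + K\<^sub>2 / real (Suc k) / real (Suc i)"
        by (rule add_divide_distrib)
      also have "K\<^sub>2 / real (Suc k) / real (Suc i) \<le> K\<^sub>2 / real (Suc k) / real (Suc k)"
        using i nn by (intro divide_left_mono mult_pos_pos divide_nonneg_nonneg) auto
      also have "\<dots> = K\<^sub>2 / (real (Suc k))\<^sup>2"
        by (simp only: power2_eq_square divide_divide_eq_left)
      also note Q
      finally have "D (Suc i) / real (Suc i) \<le> Q (Suc i) / real (Suc k) + (q * real N + K\<^sub>2) / (real (Suc k))\<^sup>2"
        unfolding add_divide_distrib by linarith
      then have "2 * \<gamma> * (D (Suc i) / real (Suc i))
          \<le> 2 * \<gamma> * (Q (Suc i) / real (Suc k) + (q * real N + K\<^sub>2) / (real (Suc k))\<^sup>2)"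
        by (rule mult_left_mono) (use const in simp)
      moreover have "c' / (real (Suc i))\<^sup>2 \<le> c' / (real (Suc k))\<^sup>2"
        using i const by (intro divide_left_mono power_mono mult_pos_pos zero_less_power) auto
      ultimately show ?thesis
        using 2(3)[OF i1] unfolding K\<^sub>3_def distrib_left add_divide_distrib
        by (simp only: times_divide_eq_left times_divide_eq_right)
    qed
    have "(norm (e (k + j)))\<^sup>2 \<le> (norm (e k))\<^sup>2
        + (\<Sum>i\<in>{k<..k + j}. 2 * \<gamma> / real i * Z i + 2 * \<gamma> / real (Suc k) * Q i + K\<^sub>3 / (real (Suc k))\<^sup>2)"
      if "j \<le> N" for j
      using that
    proof (induction j)
      case (Suc j)
      have "{k<..k + Suc j} = insert (Suc (k + j)) {k<..k + j}" by auto
      then show ?case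
        using Suc step[of "k + j"] by (simp del: of_nat_Suc)
    qed simp
    from this[OF order.refl] have "(norm (e (k + N)))\<^sup>2 \<le> (norm (e k))\<^sup>2
        + ((\<Sum>i\<in>{k<..k + N}. 2 * \<gamma> / real i * Z i) + 2 * \<gamma> / real (Suc k) * (\<Sum>i\<in>{k<..k + N}. Q i)
          + real N * (K\<^sub>3 / (real (Suc k))\<^sup>2))"
      by (simp add: sum.distrib sum_distrib_left del: of_nat_Suc)
    moreover have "2 * \<gamma> / real (Suc k) * (\<Sum>i\<in>{k<..k + N}. Q i)
        \<le> 2 * \<gamma> / real (Suc k) * (- (a * \<delta> - G) * real N * (norm (e k))\<^sup>2)"
    proof (rule mult_left_mono)
      have "(\<Sum>i\<in>{k<..k + N}. Q i) = - a * (\<Sum>i\<in>{k<..k + N}. (\<phi> i \<bullet> e k)\<^sup>2) + real N * G * (norm (e k))\<^sup>2"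
        by (simp add: Q_def sum.distrib sum_distrib_left sum_negf sum_subtractf)
      also have "\<dots> \<le> - a * (real N * \<delta> * (norm (e k))\<^sup>2) + real N * G * (norm (e k))\<^sup>2"
        using PE[OF 2(5), of "e k"] const by (intro add_right_mono mult_left_mono_neg) auto
      finally show "(\<Sum>i\<in>{k<..k + N}. Q i) \<le> - (a * \<delta> - G) * real N * (norm (e k))\<^sup>2"
        by (simp add: algebra_simps)
    qed (use const in auto)
    moreover have "2 * \<gamma> / real (Suc k) * (- (a * \<delta> - G) * real N * (norm (e k))\<^sup>2)
        = - (2 * \<gamma> * (a * \<delta> - G) * real N / real (Suc k)) * (norm (e k))\<^sup>2"
      by (simp add: field_simps del: of_nat_Suc)
    ultimately show ?case
      by (simp only: left_diff_distrib mult_1 mult_minus_left times_divide_eq_right)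
  qed
qed

section \<open>Independence of past and present noise\<close>

text \<open>The sigma-algebra generated by the variables d i with i in I. Pulling back along the
  joint map fits the independence of restrictions to disjoint index sets.\<close>

definition observed_algebra :: "'w measure \<Rightarrow> ('i \<Rightarrow> 'w \<Rightarrow> real) \<Rightarrow> 'i set \<Rightarrow> 'w measure" where
  "observed_algebra M d I = vimage_algebra (space M) (\<lambda>\<omega>. \<lambda>i\<in>I. d i \<omega>) (PiM I (\<lambda>_. borel))"

lemma space_observed_algebra [simp]: "space (observed_algebra M d I) = space M"
  by (simp add: observed_algebra_def)

lemma measurable_observed_algebra_component:
  assumes "i \<in> I"
  shows "d i \<in> borel_measurable (observed_algebra M d I)"
proof -
  have "(\<lambda>\<omega>. \<lambda>i\<in>I. d i \<omega>) \<in> measurable (observed_algebra M d I) (PiM I (\<lambda>_. borel))"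
    unfolding observed_algebra_def by (rule measurable_vimage_algebra1) (auto simp: space_PiM)
  then have "(\<lambda>\<omega>. (\<lambda>i\<in>I. d i \<omega>) i) \<in> borel_measurable (observed_algebra M d I)"
    by (rule measurable_compose) (use assms in simp)
  then show ?thesis using assms by simp
qed

lemma borel_measurable_observed_algebra_imp:
  assumes "\<And>i. i \<in> I \<Longrightarrow> d i \<in> borel_measurable M" "g \<in> borel_measurable (observed_algebra M d I)"
  shows "g \<in> borel_measurable M"
proof -
  have "sets (observed_algebra M d I) \<subseteq> sets M"
    unfolding observed_algebra_def
    by (rule sets_image_in_sets) (auto intro!: measurable_restrict assms)
  then show ?thesis
    using assms(2) by (auto simp: measurable_def)
qed

text \<open>Disjoint index sets generate independent sigma-algebras, and those generated by X and Y
  are contained in them.\<close>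

lemma (in prob_space) indep_var_observed_algebra:
  fixes X Y :: "'a \<Rightarrow> real"
  assumes indep: "indep_vars (\<lambda>_. borel) d K" and IJ: "I \<inter> J = {}" "I \<subseteq> K" "J \<subseteq> K"
    and X: "X \<in> borel_measurable (observed_algebra M d I)"
    and Y: "Y \<in> borel_measurable (observed_algebra M d J)"
  shows "indep_var borel X borel Y"
proof -
  let ?S = "\<lambda>I. sigma_sets (space M) {(\<lambda>\<omega>. \<lambda>i\<in>I. d i \<omega>) -` A \<inter> space M |A. A \<in> sets (PiM I (\<lambda>_. borel))}"
  let ?s = "\<lambda>X :: 'a \<Rightarrow> real. sigma_sets (space M) {X -` A \<inter> space M |A. A \<in> sets borel}"
  have d: "random_variable borel (d i)" if "i \<in> K" for i
    using indep that by (auto simp: indep_vars_def)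
  have "indep_set (?S I) (?S J)"
    using indep_var_restrict[OF indep IJ] by (simp only: indep_var_eq)
  moreover have "?s X \<subseteq> ?S I" if "X \<in> borel_measurable (observed_algebra M d I)" for X I
  proof -
    have "{X -` A \<inter> space M |A. A \<in> sets borel} \<subseteq> sets (observed_algebra M d I)"
      using measurable_sets[OF that] by auto
    then show ?thesis
      unfolding observed_algebra_def sets_vimage_algebra by (rule sigma_sets_mono)
  qed
  from this[OF X] this[OF Y] have "case_bool (?s X) (?s Y) b \<subseteq> case_bool (?S I) (?S J) b" for b
    by (cases b) auto
  ultimately have "indep_set (?s X) (?s Y)"
    unfolding indep_set_def by (rule indep_sets_mono_sets)
  moreover have "random_variable borel X"
    by (rule borel_measurable_observed_algebra_imp[OF _ X]) (use d IJ in auto)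
  moreover have "random_variable borel Y"
    by (rule borel_measurable_observed_algebra_imp[OF _ Y]) (use d IJ in auto)
  ultimately show ?thesis
    by (simp add: indep_var_eq)
qed

text \<open>Takes the place of conditioning on the past: the indicator is a function of the fresh
  noise alone, so the expectation factors and the indicator turns into the distribution
  function.\<close>

lemma (in prob_space) expectation_past_times_event:
  assumes indep: "indep_vars (\<lambda>_. borel) d K" and i: "I \<subseteq> K" "i \<in> K" "i \<notin> I"
    and X: "X \<in> borel_measurable (observed_algebra M d I)" "\<And>\<omega>. \<omega> \<in> space M \<Longrightarrow> \<bar>X \<omega>\<bar> \<le> b"
  shows "expectation (\<lambda>\<omega>. X \<omega> * (if d i \<omega> \<le> c then 1 else 0))
    = expectation X * cdf (distr M borel (d i)) c"
proof -
  let ?s = "\<lambda>\<omega>. if d i \<omega> \<le> c then 1 else (0::real)"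
  have d: "random_variable borel (d j)" if "j \<in> K" for j
    using indep that by (auto simp: indep_vars_def)
  have di: "d i \<in> borel_measurable (observed_algebra M d {i})"
    by (rule measurable_observed_algebra_component) simp
  have s: "?s \<in> borel_measurable (observed_algebra M d {i})"
    using di by measurable
  have Xs: "indep_var borel X borel ?s"
    by (rule indep_var_observed_algebra[OF indep _ _ _ X(1) s]) (use i in auto)
  have dM: "random_variable borel (d i)"
    using d i by blast
  have "expectation ?s = expectation (indicator (d i -` {..c} \<inter> space M))"
    by (intro Bochner_Integration.integral_cong) (auto simp: indicator_def)
  also have "\<dots> = cdf (distr M borel (d i)) c"
    using dM by (simp add: cdf_def measure_distr)
  finally have "expectation ?s = cdf (distr M borel (d i)) c" .
  moreover have "random_variable borel X"
    by (rule borel_measurable_observed_algebra_imp[OF _ X(1)]) (use d i in auto)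
  then have "integrable M X"
    using X(2) by (intro integrable_const_bound[of _ b]) auto
  moreover have "integrable M ?s"
    using dM by (intro integrable_const_bound[of _ 1]) auto
  ultimately show ?thesis
    using indep_var_lebesgue_integral[OF Xs] by simp
qed

section \<open>Mean square convergence rate\<close>

lemma borel_measurable_vec_lambda:
  fixes g :: "'i::finite \<Rightarrow> 'w \<Rightarrow> real"
  assumes "\<And>i. g i \<in> borel_measurable M"
  shows "(\<lambda>\<omega>. \<chi> i. g i \<omega>) \<in> borel_measurable M"
  by (rule borel_measurable_euclidean_space[THEN iffD2]) (auto simp: Basis_vec_def inner_axis assms)

text \<open>\<open>coord\<close> starts at 1, so only outputs strictly before time k enter; this
  makes the estimated regressor predictable.\<close>

lemma borel_measurable_regressor:
  assumes "\<And>j. j < k \<Longrightarrow> (\<lambda>\<omega>. Y j \<omega>) \<in> borel_measurable M"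
  shows "(\<lambda>\<omega>. regressor (\<lambda>j. Y j \<omega>) u k :: real ^ ('p::{finite,linorder} + 'q::{finite,linorder}))
    \<in> borel_measurable M"
  unfolding regressor_def
proof (rule borel_measurable_vec_lambda)
  fix r :: "'p + 'q"
  show "(\<lambda>\<omega>. case r of Inl i \<Rightarrow> Y (k - int (coord i)) \<omega> | Inr j \<Rightarrow> u (k - int (coord j) + 1))
      \<in> borel_measurable M"
  proof (cases r)
    case (Inl i)
    with coord_bounds(1)[of i] show ?thesis by (simp add: assms)
  qed simp
qed

lemma ar_part_regressor: "ar_part (regressor y u k) = (\<chi> i. y (k - int (coord i)))"
  by (simp add: ar_part_def regressor_def)

lemma input_part_regressor: "input_part (regressor y u k) = (\<chi> j. u (k - int (coord j) + 1))"
  by (simp add: input_part_def regressor_def)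

lemma input_part_diff: "input_part (v - w) = input_part v - input_part w"
  by (simp add: input_part_def vec_eq_iff)

lemma ar_part_diff: "ar_part (v - w) = ar_part v - ar_part w"
  by (simp add: ar_part_def vec_eq_iff)

theorem theorem2:
  fixes \<theta> :: "real ^ ('p::{finite,linorder} + 'q::{finite,linorder})"
    and \<Theta> :: "(real ^ ('p + 'q)) set"
    and Pr :: "'w measure"
    and y u :: "int \<Rightarrow> real"
    and d z s :: "nat \<Rightarrow> 'w \<Rightarrow> real"
    and F f :: "real \<Rightarrow> real"
    and thetahat :: "nat \<Rightarrow> 'w \<Rightarrow> real ^ ('p + 'q)"
    and phihat :: "nat \<Rightarrow> 'w \<Rightarrow> real ^ ('p + 'q)"
    and phi :: "nat \<Rightarrow> real ^ ('p + 'q)"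
    and yhat :: "int \<Rightarrow> 'w \<Rightarrow> real"
    and thetahat0 :: "real ^ ('p + 'q)"
    and yhat0 :: "int \<Rightarrow> real"
    and C h B \<delta>\<^sub>1 c\<^sub>0 \<delta> \<gamma> \<epsilon> h\<^sub>1 M M\<^sub>1 M\<^sub>2 f\<^sub>M f\<^sub>m :: real
    and m N p :: nat
  assumes p: "p = CARD('p)"
    \<comment> \<open>the system\<close>
    and a_p: "ar_part \<theta> $ Max UNIV \<noteq> 0"
    and no_common_root:
      "\<nexists>x. poly (ar_poly (ar_part \<theta>)) x = 0 \<and> poly (coeff_poly (input_part \<theta>)) x = 0"
    and y: "\<And>k::int. k \<ge> 1 \<Longrightarrow>
      y k = (\<Sum>i\<in>UNIV. ar_part \<theta> $ i * y (k - int (coord i)))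
          + (\<Sum>j\<in>UNIV. input_part \<theta> $ j * u (k - int (coord j) + 1))"
    and z: "\<And>k \<omega>. k \<ge> 1 \<Longrightarrow> \<omega> \<in> space Pr \<Longrightarrow> z k \<omega> = y (int k) + d k \<omega>"
    and s: "\<And>k \<omega>. k \<ge> 1 \<Longrightarrow> \<omega> \<in> space Pr \<Longrightarrow> s k \<omega> = (if z k \<omega> \<le> C then 1 else 0)"
    and phi: "\<And>k. phi k = regressor y u (int k)"
    \<comment> \<open>parameter set\<close>
    and h: "0 < h" "h < 1"
    and Theta: "convex \<Theta>" "compact \<Theta>" "\<Theta> \<subseteq> stable_params h" "\<theta> \<in> \<Theta>"
    and B: "B = (SUP v\<in>\<Theta>. norm v)"
    \<comment> \<open>noise\<close>
    and Pr: "prob_space Pr"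
    and d_indep: "prob_space.indep_vars Pr (\<lambda>_. borel) d {1..}"
    and d_distr: "\<And>k x. k \<ge> 1 \<Longrightarrow> cdf (distr Pr borel (d k)) x = F x"
    and d_mean: "\<And>k. k \<ge> 1 \<Longrightarrow> integrable Pr (d k)"
      "\<And>k. k \<ge> 1 \<Longrightarrow> prob_space.expectation Pr (d k) = 0"
    and f: "\<And>x. (F has_real_derivative f x) (at x)" "continuous_on UNIV f" "\<And>x. f x \<noteq> 0"
    \<comment> \<open>input\<close>
    and u_bounded: "bounded (u ` {1..})"
    and u_exciting: "\<delta>\<^sub>1 > 0" "m > 0"
      "\<And>k::nat. k \<ge> 1 \<Longrightarrow>
        psd_le (\<delta>\<^sub>1 *\<^sub>R mat 1)
          ((1 / real m) *\<^sub>R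
            (\<Sum>i = k..k + m - 1. outer (input_window u (int i) :: real ^ ('p + 'q))))"
    \<comment> \<open>algorithm\<close>
    and gamma: "\<gamma> > 0"
    and init: "\<And>\<omega>. \<omega> \<in> space Pr \<Longrightarrow> thetahat 0 \<omega> = thetahat0"
      "\<And>k \<omega>. k \<le> 0 \<Longrightarrow> \<omega> \<in> space Pr \<Longrightarrow> yhat k \<omega> = yhat0 k"
    and phihat: "\<And>k \<omega>. k \<ge> 1 \<Longrightarrow> \<omega> \<in> space Pr \<Longrightarrow>
      phihat k \<omega> = regressor (\<lambda>j. yhat j \<omega>) u (int k)"
    and thetahat: "\<And>k \<omega>. k \<ge> 1 \<Longrightarrow> \<omega> \<in> space Pr \<Longrightarrow>
      thetahat k \<omega> = closest_point \<Theta>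
        (thetahat (k - 1) \<omega>
          + (\<gamma> / real k) *\<^sub>R (F (C - phihat k \<omega> \<bullet> thetahat (k - 1) \<omega>) - s k \<omega>) *\<^sub>R phihat k \<omega>)"
    and yhat: "\<And>k \<omega>. k \<ge> 1 \<Longrightarrow> \<omega> \<in> space Pr \<Longrightarrow>
      yhat (int k) \<omega> = phihat k \<omega> \<bullet> thetahat k \<omega>"
    \<comment> \<open>constants\<close>
    and h1: "\<epsilon> > 0"
      "h\<^sub>1 = spec_radius (companion (ar_part \<theta>)) + \<epsilon> * op_norm (companion (ar_part \<theta>))"
      "h\<^sub>1 < 1"
    and M: "M = sqrt (real p) * (1 + 2 / \<epsilon>) ^ (p - 1)"
    and M1: "M\<^sub>1 > 0" "\<And>k. k \<ge> 1 \<Longrightarrow> norm (phi k) \<le> M\<^sub>1"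
    and M2: "M\<^sub>2 > 0" "\<And>k \<omega>. k \<ge> 1 \<Longrightarrow> \<omega> \<in> space Pr \<Longrightarrow> norm (phihat k \<omega>) \<le> M\<^sub>2"
    and fM: "f\<^sub>M = (GREATEST v. v \<in> f ` ({C - B * M\<^sub>2..C + B * M\<^sub>2} \<union> {C - B * M\<^sub>1..C + B * M\<^sub>1}))"
    and fm: "f\<^sub>m = (LEAST v. v \<in> f ` ({C - B * M\<^sub>2..C + B * M\<^sub>2} \<union> {C - B * M\<^sub>1..C + B * M\<^sub>1}))"
    and c0: "c\<^sub>0 > 0"
      "\<And>k::nat. k > 0 \<Longrightarrow>
        lambda_min (\<Sum>i = k..k + p + m - 1. outer (phi i))
          \<ge> c\<^sub>0 * lambda_min ((1 / real m) *\<^sub>R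
              (\<Sum>i = k + p..k + p + m - 1. outer (input_window u (int i) :: real ^ ('p + 'q))))"
    and N: "N = p + m"
    and delta: "\<delta> = c\<^sub>0 * \<delta>\<^sub>1 / real N"
    \<comment> \<open>hypotheses of the theorem\<close>
    and gap: "f\<^sub>m * \<delta> - f\<^sub>M * sqrt (g_bound p h) * M\<^sub>2 * M / (1 - h\<^sub>1) * (M\<^sub>2 + 2 * M\<^sub>1) > 0"
    and step: "\<gamma> > 1 / (2 * (f\<^sub>m * \<delta>
                  - f\<^sub>M * sqrt (g_bound p h) * M\<^sub>2 * M / (1 - h\<^sub>1) * (M\<^sub>2 + 2 * M\<^sub>1)))"
  shows "(\<lambda>k. prob_space.expectation Pr (\<lambda>\<omega>. (thetahat k \<omega> - \<theta>) \<bullet> (thetahat k \<omega> - \<theta>)))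
           \<in> O(\<lambda>k. 1 / real k)"
proof -
  interpret prob_space Pr by (fact Pr)

  \<comment> \<open>Stability and bounds over the parameter set\<close>
  define a where "a = ar_part \<theta>"
  define A where "A = companion a"
  define g where "g = sqrt (g_bound p h)"
  define G where "G = f\<^sub>M * g * M\<^sub>2 * M / (1 - h\<^sub>1) * (M\<^sub>2 + 2 * M\<^sub>1)"
  \<comment> \<open>The two intervals defining \<open>f\<^sub>M\<close> and \<open>f\<^sub>m\<close>
    are both centred at C; R is the larger of their radii and bounds the true and the estimated
    prediction.\<close>
  define R where "R = B * max M\<^sub>1 M\<^sub>2"

  have g0: "0 \<le> g"
    by (simp add: g_def g_bound_def sum_nonneg h(1) less_imp_le)
  have M0: "0 \<le> M"
    using h1(1) by (simp add: M)
  have a0: "a \<noteq> 0"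
    using a_p by (auto simp: a_def)
  have h1_0: "0 \<le> h\<^sub>1"
    unfolding h1(2) using h1(1) by (simp add: spec_radius_companion_nonneg op_norm_nonneg)
  have A_power: "norm (((*v) A ^^ k) v) \<le> M * h\<^sub>1 ^ k * norm v" for k v
  proof -
    \<comment> \<open>The power bound above comes without sqrt p; being at least 1, this factor may
      be inserted to reach M.\<close>
    have "1 \<le> sqrt (real p)"
      using p zero_less_card_finite[where 'a='p] by simp
    then have "1 * (1 + 2 / \<epsilon>) ^ (p - 1) \<le> M"
      unfolding M using h1(1) by (intro mult_right_mono) auto
    then have "(1 + 2 / \<epsilon>) ^ (p - 1) * h\<^sub>1 ^ k * norm v \<le> M * h\<^sub>1 ^ k * norm v"
      using h1_0 by (intro mult_right_mono) auto
    then show ?thesis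
      using norm_companion_funpow_le[OF a0 h1(1), of k v] by (simp add: A_def a_def h1(2) p)
  qed

  have \<Theta>_closed: "closed \<Theta>"
    using Theta(2) by (rule compact_imp_closed)
  have \<Theta>_B: "norm v \<le> B" if "v \<in> \<Theta>" for v
    unfolding B
  proof (rule cSUP_upper[OF that])
    show "bdd_above (norm ` \<Theta>)"
      using compact_imp_bounded[OF Theta(2)] by (auto simp: bounded_iff bdd_above_def)
  qed
  have B0: "0 \<le> B"
    using \<Theta>_B[OF Theta(4)] norm_ge_zero order.trans by blast
  have \<Theta>_g: "norm (ar_part v) \<le> g" if "v \<in> \<Theta>" for v
    unfolding g_def p using norm_ar_part_le[OF h(1)] Theta(3) that by blast

  \<comment> \<open>Noise distribution and bounds on its density\<close>
  have d_rv: "random_variable borel (d i)" if "i \<ge> 1" for i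
    using d_indep that by (auto simp: indep_vars_def)
  interpret D: real_distribution "distr Pr borel (d (Suc 0))"
    using d_rv by simp
  have F_cdf: "F x = cdf (distr Pr borel (d (Suc 0))) x" for x
    using d_distr by simp
  have F_bounds: "0 \<le> F x" "F x \<le> 1" for x
    by (simp_all add: F_cdf D.cdf_nonneg D.cdf_bounded_prob)
  have "mono F"
    by (auto simp: mono_def F_cdf D.cdf_nondecreasing)
  then have f_nonneg: "0 \<le> f x" for x
    using mono_on_imp_deriv_nonneg[of UNIV F "f x" x] f(1) by simp
  have F_cont: "continuous_on UNIV F"
    using f(1) by (meson DERIV_isCont continuous_at_imp_continuous_on)

  let ?I = "{C - B * M\<^sub>2..C + B * M\<^sub>2} \<union> {C - B * M\<^sub>1..C + B * M\<^sub>1}"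
  have f_cont: "continuous_on ?I f"
    using f(2) continuous_on_subset by blast
  have "compact ?I"
    by (intro compact_Un compact_Icc)
  have CI: "C \<in> ?I"
    using B0 M1(1) by auto
  \<comment> \<open>The extrema are attained by compactness; only then do \<open>GREATEST\<close>
    and \<open>LEAST\<close> denote them.\<close>
  obtain x\<^sub>M where xM: "x\<^sub>M \<in> ?I" "\<And>x. x \<in> ?I \<Longrightarrow> f x \<le> f x\<^sub>M"
    using continuous_attains_sup[OF \<open>compact ?I\<close> _ f_cont] CI by blast
  obtain x\<^sub>m where xm: "x\<^sub>m \<in> ?I" "\<And>x. x \<in> ?I \<Longrightarrow> f x\<^sub>m \<le> f x"
    using continuous_attains_inf[OF \<open>compact ?I\<close> _ f_cont] CI by blast
  have "f\<^sub>M = f x\<^sub>M"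
    unfolding fM using xM by (intro Greatest_equality) auto
  moreover have "f\<^sub>m = f x\<^sub>m"
    unfolding fm using xm by (intro Least_equality) auto
  moreover have "x \<in> ?I" if "\<bar>x - C\<bar> \<le> R" for x
    using that B0 by (auto simp: R_def max_def abs_le_iff split: if_splits)
  ultimately have f_bounds: "\<bar>x - C\<bar> \<le> R \<Longrightarrow> f\<^sub>m \<le> f x \<and> f x \<le> f\<^sub>M"
    and fm0: "0 \<le> f\<^sub>m" and fM0: "0 \<le> f\<^sub>M" for x
    using xM(2) xm(2) f_nonneg by auto
  have G0: "0 \<le> G"
    using fM0 g0 M0 M1(1) M2(1) h1(3) by (simp add: G_def)
  have inner_R: "\<bar>v \<bullet> w\<bar> \<le> R" if "w \<in> \<Theta>" "norm v \<le> M\<^sub>1 \<or> norm v \<le> M\<^sub>2" for v w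
  proof -
    have "norm v \<le> max M\<^sub>1 M\<^sub>2" using that by auto
    then have "norm v * norm w \<le> max M\<^sub>1 M\<^sub>2 * B"
      using \<Theta>_B[OF that(1)] M1(1) by (intro mult_mono) auto
    then show ?thesis
      using Cauchy_Schwarz_ineq2[of v w] by (simp add: R_def mult.commute)
  qed

  \<comment> \<open>Excitation of the true regressor\<close>
  have y_inner: "y (int k) = phi k \<bullet> \<theta>" if "k \<ge> 1" for k
    using y[of "int k"] that
    by (simp add: inner_sum_type phi ar_part_regressor input_part_regressor inner_vec_def mult.commute)

  have N0: "N > 0"
    using N u_exciting(2) by simp
  have PE: "real N * \<delta> * (norm w)\<^sup>2 \<le> (\<Sum>i\<in>{k<..k + N}. (phi i \<bullet> w)\<^sup>2)" if "k \<ge> 1" for k w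
  proof -
    \<comment> \<open>The input condition is taken at time Suc k + p, whose window of m inputs is
      the one paired with the regressors from Suc k on.\<close>
    have "c\<^sub>0 * \<delta>\<^sub>1 * (norm w)\<^sup>2 \<le> (\<Sum>i = Suc k..Suc k + p + m - 1. (phi i \<bullet> w)\<^sup>2)"
      by (rule excitation_from_lambda_min[OF less_imp_le[OF c0(1)] c0(2) u_exciting(3)]) auto
    moreover have "{Suc k..Suc k + p + m - 1} = {k<..k + N}"
      by (auto simp: N)
    moreover have "real N * \<delta> = c\<^sub>0 * \<delta>\<^sub>1"
      using N0 by (simp add: delta)
    ultimately show ?thesis by simp
  qed

  \<comment> \<open>One-step recursion of the error\<close>
  define e where "e \<omega> k = thetahat k \<omega> - \<theta>" for \<omega> k
  \<comment> \<open>The window ends at time k and is therefore the autoregressive block of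
    \<open>phihat - phi\<close> at time k + 1.\<close>
  define X where "X \<omega> k = (\<chi> i::'p. yhat (int k - int (coord i) + 1) \<omega> - y (int k - int (coord i) + 1))" for \<omega> k
  \<comment> \<open>\<open>F (C - phi i \<bullet> \<theta>)\<close> is the probability that
    \<open>s i\<close> is 1. Inserting it splits the innovation into Z, which has mean zero, and D,
    which depends on earlier noise only.\<close>
  define Z where "Z \<omega> i = (e \<omega> (i - 1) \<bullet> phihat i \<omega>) * (F (C - phi i \<bullet> \<theta>) - s i \<omega>)" for \<omega> i
  define D where "D \<omega> i = (e \<omega> (i - 1) \<bullet> phihat i \<omega>)
      * (F (C - phihat i \<omega> \<bullet> thetahat (i - 1) \<omega>) - F (C - phi i \<bullet> \<theta>))" for \<omega> i

  \<comment> \<open>The initial estimate may lie outside \<open>\<Theta>\<close>; the first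
    projection occurs at k = 1, where all bounds start.\<close>
  have th_in: "thetahat k \<omega> \<in> \<Theta>" if "k \<ge> 1" "\<omega> \<in> space Pr" for k \<omega>
    using thetahat[OF that] closest_point_in_set[OF \<Theta>_closed] Theta(4) by auto
  have e_bound: "norm (e \<omega> k) \<le> 2 * B" if "k \<ge> 1" "\<omega> \<in> space Pr" for k \<omega>
    unfolding e_def using norm_triangle_ineq4[of "thetahat k \<omega>" \<theta>] \<Theta>_B[OF th_in[OF that]] \<Theta>_B[OF Theta(4)]
    by simp
  have s_bounds: "0 \<le> s k \<omega>" "s k \<omega> \<le> 1" if "k \<ge> 1" "\<omega> \<in> space Pr" for k \<omega>
    using s[OF that] by auto
  define upd where "upd \<omega> i = (\<gamma> / real (Suc i)) *\<^sub>R (F (C - phihat (Suc i) \<omega> \<bullet> thetahat i \<omega>) - s (Suc i) \<omega>)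
      *\<^sub>R phihat (Suc i) \<omega>" for \<omega> i
  have th_Suc: "thetahat (Suc i) \<omega> = closest_point \<Theta> (thetahat i \<omega> + upd \<omega> i)" if "\<omega> \<in> space Pr" for i \<omega>
    using thetahat[of "Suc i" \<omega>] that by (simp add: upd_def)
  have upd_bound: "norm (upd \<omega> i) \<le> \<gamma> * M\<^sub>2 / real (Suc i)" if "\<omega> \<in> space Pr" for i \<omega>
  proof -
    have "\<bar>F (C - phihat (Suc i) \<omega> \<bullet> thetahat i \<omega>) - s (Suc i) \<omega>\<bar> \<le> 1"
      using F_bounds[of "C - phihat (Suc i) \<omega> \<bullet> thetahat i \<omega>"] s_bounds[of "Suc i" \<omega>] that by (auto simp: abs_le_iff)
    then have "\<bar>F (C - phihat (Suc i) \<omega> \<bullet> thetahat i \<omega>) - s (Suc i) \<omega>\<bar> * norm (phihat (Suc i) \<omega>) \<le> 1 * M\<^sub>2"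
      using M2(2)[of "Suc i" \<omega>] that by (intro mult_mono) auto
    then have "\<gamma> / real (Suc i) * (\<bar>F (C - phihat (Suc i) \<omega> \<bullet> thetahat i \<omega>) - s (Suc i) \<omega>\<bar>
        * norm (phihat (Suc i) \<omega>)) \<le> \<gamma> / real (Suc i) * (1 * M\<^sub>2)"
      using gamma by (intro mult_left_mono) auto
    then show ?thesis
      using gamma by (simp add: upd_def abs_mult del: of_nat_Suc)
  qed
  have e_step: "norm (e \<omega> (Suc i) - e \<omega> i) \<le> \<gamma> * M\<^sub>2 / real (Suc i)" if "i \<ge> 1" "\<omega> \<in> space Pr" for i \<omega>
    using norm_closest_point_diff_le[OF Theta(1) \<Theta>_closed th_in[OF that], of "thetahat i \<omega> + upd \<omega> i"]
      upd_bound[OF that(2), of i] that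
    by (simp add: e_def th_Suc)
  have e_sq: "(norm (e \<omega> (Suc i)))\<^sup>2 \<le> (norm (e \<omega> i))\<^sup>2 + 2 * \<gamma> / real (Suc i) * (Z \<omega> (Suc i) + D \<omega> (Suc i))
      + (\<gamma> * M\<^sub>2)\<^sup>2 / (real (Suc i))\<^sup>2" if "\<omega> \<in> space Pr" for i \<omega>
  proof -
    have "norm (e \<omega> (Suc i)) \<le> norm (e \<omega> i + upd \<omega> i)"
      using norm_closest_point_diff_le[OF Theta(1) \<Theta>_closed Theta(4), of "thetahat i \<omega> + upd \<omega> i"] that
      by (simp add: e_def th_Suc algebra_simps)
    then have "(norm (e \<omega> (Suc i)))\<^sup>2 \<le> (norm (e \<omega> i + upd \<omega> i))\<^sup>2"
      by (intro power_mono) auto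
    also have "\<dots> = (norm (e \<omega> i))\<^sup>2 + 2 * (e \<omega> i \<bullet> upd \<omega> i) + (norm (upd \<omega> i))\<^sup>2"
      by (simp add: power2_norm_eq_inner inner_add_left inner_add_right inner_commute)
    also have "e \<omega> i \<bullet> upd \<omega> i = \<gamma> / real (Suc i) * (Z \<omega> (Suc i) + D \<omega> (Suc i))"
      by (simp add: upd_def Z_def D_def algebra_simps)
    also have "(norm (upd \<omega> i))\<^sup>2 \<le> (\<gamma> * M\<^sub>2 / real (Suc i))\<^sup>2"
      using upd_bound[OF that] by (intro power_mono) auto
    finally show ?thesis
      by (simp add: power_divide del: of_nat_Suc)
  qed

  \<comment> \<open>State equation of the output errors\<close>
  obtain i\<^sub>1 :: 'p where i1: "coord i\<^sub>1 = 1"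
    using obtain_coord[of 1] zero_less_card_finite[where 'a='p] by (metis One_nat_def Suc_leI order_refl)
  define b where "b = axis i\<^sub>1 (1::real)"
  have X_ar: "X \<omega> k = ar_part (phihat (Suc k) \<omega>) - ar_part (phi (Suc k))" if "\<omega> \<in> space Pr" for \<omega> k
  proof -
    have ph: "phihat (Suc k) \<omega> = regressor (\<lambda>j. yhat j \<omega>) u (int (Suc k))"
      using that by (intro phihat) auto
    show ?thesis
      unfolding ph phi ar_part_regressor by (simp add: X_def vec_eq_iff algebra_simps)
  qed
  have input_eq: "input_part (phihat (Suc k) \<omega>) = input_part (phi (Suc k))" if "\<omega> \<in> space Pr" for \<omega> k
    using phihat[of "Suc k" \<omega>] that by (simp add: phi input_part_regressor)
  \<comment> \<open>The first coordinate is \<phi>' \<bullet> \<theta>' - \<phi> \<bullet> \<theta>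
    = \<phi>' \<bullet> e + (\<phi>' - \<phi>) \<bullet> \<theta>, and the last term sees only the
    autoregressive blocks. The error is the updated one, because \<open>yhat\<close> uses the
    estimate of its own time. All other coordinates shift.\<close>
  have X_Suc: "X \<omega> (Suc k) = A *v X \<omega> k + (phihat (Suc k) \<omega> \<bullet> e \<omega> (Suc k)) *\<^sub>R b" if "\<omega> \<in> space Pr" for \<omega> k
    unfolding vec_eq_iff
  proof
    fix i :: 'p
    show "X \<omega> (Suc k) $ i = (A *v X \<omega> k + (phihat (Suc k) \<omega> \<bullet> e \<omega> (Suc k)) *\<^sub>R b) $ i"
    proof (cases "coord i = 1")
      case True
      then have "i = i\<^sub>1" using i1 by (metis coord_eq_iff)
      have "X \<omega> (Suc k) $ i = phihat (Suc k) \<omega> \<bullet> thetahat (Suc k) \<omega> - phi (Suc k) \<bullet> \<theta>"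
        using yhat[of "Suc k" \<omega>] y_inner[of "Suc k"] that True by (simp add: X_def)
      also have "\<dots> = phihat (Suc k) \<omega> \<bullet> e \<omega> (Suc k) + a \<bullet> X \<omega> k"
      proof -
        have "(phihat (Suc k) \<omega> - phi (Suc k)) \<bullet> \<theta> = a \<bullet> X \<omega> k"
          unfolding inner_sum_type[of "phihat (Suc k) \<omega> - phi (Suc k)"] ar_part_diff input_part_diff
            X_ar[OF that, symmetric] input_eq[OF that] a_def
          by (simp add: inner_commute)
        then show ?thesis by (simp add: e_def inner_diff_left inner_diff_right)
      qed
      finally show ?thesis
        using companion_mult_vec_real(1)[OF True] \<open>i = i\<^sub>1\<close> by (simp add: A_def b_def axis_def)
    next
      case False
      then have "coord i - 1 \<in> {1..CARD('p)}"
        using coord_bounds[of i] by auto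
      then obtain j :: 'p where j: "coord j = coord i - 1"
        using obtain_coord by (metis atLeastAtMost_iff)
      then have ij: "coord i = coord j + 1"
        using False coord_bounds[of i] by simp
      have "i \<noteq> i\<^sub>1" using False i1 by auto
      have "X \<omega> (Suc k) $ i = X \<omega> k $ j"
        by (simp add: X_def ij algebra_simps)
      then show ?thesis
        using companion_mult_vec_real(2)[OF ij] \<open>i \<noteq> i\<^sub>1\<close> by (simp add: A_def b_def axis_def)
    qed
  qed
  \<comment> \<open>The initial window is the same for all realizations, so a single
    \<open>K\<^sub>x\<close> serves every \<omega>.\<close>
  define x\<^sub>0 where "x\<^sub>0 = (\<chi> i::'p. yhat0 (1 - int (coord i)) - y (1 - int (coord i)))"
  have X_0: "X \<omega> 0 = x\<^sub>0" if "\<omega> \<in> space Pr" for \<omega>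
    using that coord_bounds(1)[where 'n='p] by (simp add: X_def x\<^sub>0_def vec_eq_iff init(2))
  obtain K\<^sub>x where Kx: "K\<^sub>x \<ge> 0"
    "\<And>X w r. \<lbrakk>X 0 = x\<^sub>0; \<And>k. X (Suc k) = A *v X k + w (Suc k) *\<^sub>R b;
        \<And>k. k \<ge> 1 \<Longrightarrow> \<bar>w k\<bar> \<le> M\<^sub>2 * r k; \<And>k. k \<ge> 1 \<Longrightarrow> \<bar>r (Suc k) - r k\<bar> \<le> \<gamma> * M\<^sub>2 / real (Suc k);
        0 \<le> r 1; r 1 \<le> 2 * B\<rbrakk> \<Longrightarrow> \<forall>k\<ge>1. norm (X k) \<le> M * M\<^sub>2 / (1 - h\<^sub>1) * r k + K\<^sub>x / real k"
    using driven_state_bound[OF A_power h1_0 h1(3) M0, of b M\<^sub>2 "2 * B" "\<gamma> * M\<^sub>2" x\<^sub>0] M2(1) B0 gamma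
    by (auto simp: b_def norm_axis_1)
  have X_bound: "norm (X \<omega> k) \<le> M * M\<^sub>2 / (1 - h\<^sub>1) * norm (e \<omega> k) + K\<^sub>x / real k"
    if "k \<ge> 1" "\<omega> \<in> space Pr" for k \<omega>
  proof -
    have "\<forall>k\<ge>1. norm (X \<omega> k) \<le> M * M\<^sub>2 / (1 - h\<^sub>1) * norm (e \<omega> k) + K\<^sub>x / real k"
    proof (rule Kx(2)[of "X \<omega>" "\<lambda>k. phihat k \<omega> \<bullet> e \<omega> k"])
      show "\<bar>phihat k \<omega> \<bullet> e \<omega> k\<bar> \<le> M\<^sub>2 * norm (e \<omega> k)" if "k \<ge> 1" for k
        using M2(2)[OF that \<open>\<omega> \<in> space Pr\<close>]
        by (intro order.trans[OF Cauchy_Schwarz_ineq2] mult_right_mono) auto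
      show "\<bar>norm (e \<omega> (Suc k)) - norm (e \<omega> k)\<bar> \<le> \<gamma> * M\<^sub>2 / real (Suc k)" if "k \<ge> 1" for k
        using e_step[OF that \<open>\<omega> \<in> space Pr\<close>] norm_triangle_ineq3 order.trans by blast
    qed (use that X_0 X_Suc e_bound[of 1 \<omega>] in auto)
    with that show ?thesis by blast
  qed
  define b' where "b' = f\<^sub>M * g * (M\<^sub>2 + 2 * M\<^sub>1) * (2 * B * K\<^sub>x)"
  have D_bound: "D \<omega> (Suc i) \<le> - f\<^sub>m * (phi (Suc i) \<bullet> e \<omega> i)\<^sup>2 + G * (norm (e \<omega> i))\<^sup>2 + b' / real i"
    if "i \<ge> 1" "\<omega> \<in> space Pr" for i \<omega>
  proof -
    have "D \<omega> (Suc i) \<le> - f\<^sub>m * (phi (Suc i) \<bullet> e \<omega> i)\<^sup>2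
        + f\<^sub>M * g * (M\<^sub>2 + 2 * M\<^sub>1) * (norm (e \<omega> i) * norm (X \<omega> i))"
      using expected_update_le[where \<phi>="phi (Suc i)" and \<phi>'="phihat (Suc i) \<omega>" and \<theta>=\<theta> and \<theta>'="thetahat i \<omega>"
          and C=C and R=R and g=g, OF f(1) f_nonneg f_bounds]
        inner_R th_in[OF that] Theta(4) M1(2)[of "Suc i"] M2(2)[of "Suc i" \<omega>] \<Theta>_g input_eq that
      by (simp add: D_def e_def X_ar)
    also have "norm (e \<omega> i) * norm (X \<omega> i) \<le> norm (e \<omega> i) * (M * M\<^sub>2 / (1 - h\<^sub>1) * norm (e \<omega> i) + K\<^sub>x / real i)"
      using X_bound[OF that] by (intro mult_left_mono) auto
    also have "\<dots> \<le> M * M\<^sub>2 / (1 - h\<^sub>1) * (norm (e \<omega> i))\<^sup>2 + 2 * B * K\<^sub>x / real i"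
    proof -
      have "norm (e \<omega> i) * (K\<^sub>x / real i) \<le> 2 * B * (K\<^sub>x / real i)"
        using e_bound[OF that] Kx(1) by (intro mult_right_mono) auto
      then show ?thesis
        by (simp add: distrib_left power2_eq_square mult_ac)
    qed
    finally have "D \<omega> (Suc i) \<le> - f\<^sub>m * (phi (Suc i) \<bullet> e \<omega> i)\<^sup>2 + f\<^sub>M * g * (M\<^sub>2 + 2 * M\<^sub>1)
        * (M * M\<^sub>2 / (1 - h\<^sub>1) * (norm (e \<omega> i))\<^sup>2 + 2 * B * K\<^sub>x / real i)"
      using fM0 g0 M1(1) M2(1) by (simp add: mult_left_mono)
    also have "\<dots> = - f\<^sub>m * (phi (Suc i) \<bullet> e \<omega> i)\<^sup>2 + G * (norm (e \<omega> i))\<^sup>2 + b' / real i"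
      by (simp add: G_def b'_def distrib_left add_divide_distrib mult_ac)
    finally show ?thesis .
  qed

  \<comment> \<open>Pathwise block inequality\<close>
  obtain K where K: "K \<ge> 0"
    "\<And>e Z D k. \<lbrakk>\<And>i. i \<ge> 1 \<Longrightarrow> norm (e i) \<le> 2 * B;
        \<And>i. i \<ge> 1 \<Longrightarrow> norm (e (Suc i) - e i) \<le> \<gamma> * M\<^sub>2 / real (Suc i);
        \<And>i. i \<ge> 1 \<Longrightarrow> (norm (e (Suc i)))\<^sup>2
          \<le> (norm (e i))\<^sup>2 + 2 * \<gamma> / real (Suc i) * (Z (Suc i) + D (Suc i)) + (\<gamma> * M\<^sub>2)\<^sup>2 / (real (Suc i))\<^sup>2;
        \<And>i. i \<ge> 1 \<Longrightarrow> D (Suc i) \<le> - f\<^sub>m * (phi (Suc i) \<bullet> e i)\<^sup>2 + G * (norm (e i))\<^sup>2 + b' / real i; k \<ge> 1\<rbrakk>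
      \<Longrightarrow> (norm (e (k + N)))\<^sup>2 \<le> (1 - 2 * \<gamma> * (f\<^sub>m * \<delta> - G) * real N / real (Suc k)) * (norm (e k))\<^sup>2
          + (\<Sum>i\<in>{k<..k + N}. 2 * \<gamma> / real i * Z i) + K / (real (Suc k))\<^sup>2"
  proof (rule block_descent[where \<gamma>=\<gamma> and a=f\<^sub>m and G=G and R="2 * B" and c="\<gamma> * M\<^sub>2" and c'="(\<gamma> * M\<^sub>2)\<^sup>2"
        and b=b' and \<phi>=phi and M=M\<^sub>1 and N=N and \<delta>=\<delta>])
    show "0 \<le> b'"
      using fM0 g0 M1(1) M2(1) B0 Kx(1) by (simp add: b'_def)
  qed (use gamma fm0 G0 B0 M1 M2(1) PE in auto)
  have block: "(norm (e \<omega> (k + N)))\<^sup>2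
      \<le> (1 - 2 * \<gamma> * (f\<^sub>m * \<delta> - G) * real N / real (Suc k)) * (norm (e \<omega> k))\<^sup>2
        + (\<Sum>i\<in>{k<..k + N}. 2 * \<gamma> / real i * Z \<omega> i) + K / (real (Suc k))\<^sup>2"
    if "k \<ge> 1" "\<omega> \<in> space Pr" for k \<omega>
    by (rule K(2)[of "e \<omega>" "Z \<omega>" "D \<omega>"]) (use e_bound e_step e_sq D_bound that in auto)

  \<comment> \<open>Measurability with respect to past noise\<close>
  have adapted: "thetahat j \<in> borel_measurable (observed_algebra Pr d {1..n})
      \<and> yhat (int j) \<in> borel_measurable (observed_algebra Pr d {1..n})" if "j \<le> n" for j n
    using that
  \<comment> \<open>Strong induction, since the regressor reaches back several steps. The
    sigma-algebra is that of the first n noises throughout, which avoids comparing sigma-algebras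
    for different times.\<close>
  proof (induction j rule: less_induct)
    case (less j)
    let ?O = "observed_algebra Pr d {1..n}"
    have yhat0_meas: "yhat i \<in> borel_measurable ?O" if "i \<le> 0" for i
      by (subst measurable_cong[where g="\<lambda>_. yhat0 i"]) (use init(2) that in auto)
    show ?case
    proof (cases "j = 0")
      case True
      have "thetahat 0 \<in> borel_measurable ?O"
        by (subst measurable_cong[where g="\<lambda>_. thetahat0"]) (use init(1) in auto)
      with True yhat0_meas show ?thesis by simp
    next
      case False
      then have j: "j \<ge> 1" "j - 1 < j" "j - 1 \<le> n" using less.prems by auto
      have yhat_past: "yhat i \<in> borel_measurable ?O" if "i < int j" for i
      proof (cases "i \<le> 0")
        case False
        then have "int (nat i) = i" "nat i < j" using that by auto
        with less.IH[of "nat i"] less.prems show ?thesis by simp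
      qed (rule yhat0_meas)
      have "phihat j \<in> borel_measurable ?O \<longleftrightarrow> (\<lambda>\<omega>. regressor (\<lambda>i. yhat i \<omega>) u (int j) :: real ^ ('p + 'q)) \<in> borel_measurable ?O"
        by (rule measurable_cong) (rule phihat[OF j(1)], simp)
      moreover have "(\<lambda>\<omega>. regressor (\<lambda>i. yhat i \<omega>) u (int j) :: real ^ ('p + 'q)) \<in> borel_measurable ?O"
        by (rule borel_measurable_regressor) (rule yhat_past)
      ultimately have ph: "phihat j \<in> borel_measurable ?O"
        by simp
      have th': "thetahat (j - 1) \<in> borel_measurable ?O"
        using less.IH[OF j(2,3)] by simp
      have dj: "d j \<in> borel_measurable ?O"
        using j less.prems by (intro measurable_observed_algebra_component) auto
      have "s j \<in> borel_measurable ?O \<longleftrightarrow> (\<lambda>\<omega>. if y (int j) + d j \<omega> \<le> C then 1 else (0::real)) \<in> borel_measurable ?O"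
        by (rule measurable_cong) (simp add: s[OF j(1)] z[OF j(1)])
      then have sj: "s j \<in> borel_measurable ?O"
        using dj by simp
      have F_meas: "F \<in> borel_measurable borel"
        using F_cont by (rule borel_measurable_continuous_onI)
      have "closest_point \<Theta> \<in> borel_measurable borel"
        using continuous_on_closest_point[OF Theta(1) \<Theta>_closed] Theta(4)
        by (intro borel_measurable_continuous_onI) auto
      then have "(\<lambda>\<omega>. closest_point \<Theta> (thetahat (j - 1) \<omega>
          + (\<gamma> / real j) *\<^sub>R (F (C - phihat j \<omega> \<bullet> thetahat (j - 1) \<omega>) - s j \<omega>) *\<^sub>R phihat j \<omega>)) \<in> borel_measurable ?O"
        using ph th' sj F_meas by measurable
      moreover have "thetahat j \<in> borel_measurable ?O \<longleftrightarrow> (\<lambda>\<omega>. closest_point \<Theta> (thetahat (j - 1) \<omega>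
          + (\<gamma> / real j) *\<^sub>R (F (C - phihat j \<omega> \<bullet> thetahat (j - 1) \<omega>) - s j \<omega>) *\<^sub>R phihat j \<omega>)) \<in> borel_measurable ?O"
        by (rule measurable_cong) (rule thetahat[OF j(1)], simp)
      ultimately have th: "thetahat j \<in> borel_measurable ?O" by simp
      have "yhat (int j) \<in> borel_measurable ?O \<longleftrightarrow> (\<lambda>\<omega>. phihat j \<omega> \<bullet> thetahat j \<omega>) \<in> borel_measurable ?O"
        by (rule measurable_cong) (rule yhat[OF j(1)], simp)
      with ph th show ?thesis by simp
    qed
  qed
  \<comment> \<open>The regressor of time n + 1 sees noise up to time n only and is thus independent
    of \<open>d (Suc n)\<close>.\<close>
  have phihat_adapted: "phihat (Suc n) \<in> borel_measurable (observed_algebra Pr d {1..n})" for n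
  proof -
    have "yhat i \<in> borel_measurable (observed_algebra Pr d {1..n})" if "i < int (Suc n)" for i
    proof (cases "i \<le> 0")
      case True
      then show ?thesis
        by (subst measurable_cong[where g="\<lambda>_. yhat0 i"]) (use init(2) in auto)
    next
      case False
      then have "int (nat i) = i" "nat i \<le> n" using that by auto
      with adapted[of "nat i" n] show ?thesis by simp
    qed
    moreover have "phihat (Suc n) \<in> borel_measurable (observed_algebra Pr d {1..n})
        \<longleftrightarrow> (\<lambda>\<omega>. regressor (\<lambda>i. yhat i \<omega>) u (int (Suc n)) :: real ^ ('p + 'q)) \<in> borel_measurable (observed_algebra Pr d {1..n})"
      by (rule measurable_cong) (simp add: phihat)
    moreover from calculation(1)
    have "(\<lambda>\<omega>. regressor (\<lambda>i. yhat i \<omega>) u (int (Suc n)) :: real ^ ('p + 'q))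
        \<in> borel_measurable (observed_algebra Pr d {1..n})"
      by (rule borel_measurable_regressor)
    ultimately show ?thesis by simp
  qed
  have observed: "v \<in> borel_measurable Pr" if "v \<in> borel_measurable (observed_algebra Pr d {1..n})"
    for v :: "'w \<Rightarrow> 'b::topological_space" and n
    by (rule borel_measurable_observed_algebra_imp[OF _ that]) (use d_rv in auto)
  have th_rv: "thetahat k \<in> borel_measurable Pr" for k
    using observed adapted by blast

  \<comment> \<open>The noise terms have mean zero\<close>
  have W_adapted: "(\<lambda>\<omega>. e \<omega> n \<bullet> phihat (Suc n) \<omega>) \<in> borel_measurable (observed_algebra Pr d {1..n})" for n
    unfolding e_def
    by (intro borel_measurable_inner borel_measurable_diff phihat_adapted conjunct1[OF adapted]) auto
  have W_bound: "\<bar>e \<omega> n \<bullet> phihat (Suc n) \<omega>\<bar> \<le> 2 * B * M\<^sub>2" if "n \<ge> 1" "\<omega> \<in> space Pr" for n \<omega>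
    using e_bound[OF that] M2(2)[of "Suc n" \<omega>] that B0
    by (intro order.trans[OF Cauchy_Schwarz_ineq2] mult_mono) auto
  have W_int: "integrable Pr (\<lambda>\<omega>. e \<omega> n \<bullet> phihat (Suc n) \<omega>)" if "n \<ge> 1" for n
    using W_bound[OF that] observed[OF W_adapted[of n]]
    by (intro integrable_const_bound[of _ "2 * B * M\<^sub>2"]) auto
  \<comment> \<open>The outputs y are deterministic, so \<open>s (Suc n)\<close> is the indicator
    that \<open>d (Suc n)\<close> stays below a constant threshold.\<close>
  have Z_eq: "Z \<omega> (Suc n) = F (C - y (int (Suc n))) * (e \<omega> n \<bullet> phihat (Suc n) \<omega>)
      - (e \<omega> n \<bullet> phihat (Suc n) \<omega>) * (if d (Suc n) \<omega> \<le> C - y (int (Suc n)) then 1 else 0)"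
    if "\<omega> \<in> space Pr" for n \<omega>
    using that y_inner[of "Suc n"] by (auto simp: Z_def s z algebra_simps)
  have Ws_int: "integrable Pr (\<lambda>\<omega>. (e \<omega> n \<bullet> phihat (Suc n) \<omega>)
      * (if d (Suc n) \<omega> \<le> C - y (int (Suc n)) then 1 else 0))" if "n \<ge> 1" for n
  proof (rule integrable_const_bound[of _ "2 * B * M\<^sub>2"])
    show "AE \<omega> in Pr. norm ((e \<omega> n \<bullet> phihat (Suc n) \<omega>) * (if d (Suc n) \<omega> \<le> C - y (int (Suc n)) then 1 else 0))
        \<le> 2 * B * M\<^sub>2"
      using W_bound[OF that] B0 M2(1) by (intro AE_I2) auto
    show "(\<lambda>\<omega>. (e \<omega> n \<bullet> phihat (Suc n) \<omega>) * (if d (Suc n) \<omega> \<le> C - y (int (Suc n)) then 1 else 0))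
        \<in> borel_measurable Pr"
      using observed[OF W_adapted[of n]] d_rv[of "Suc n"] by simp
  qed
  have Z_int: "integrable Pr (\<lambda>\<omega>. Z \<omega> (Suc n))" if "n \<ge> 1" for n
    by (subst Bochner_Integration.integrable_cong[OF refl Z_eq])
      (use W_int[OF that] Ws_int[OF that] in auto)
  have Z_mean: "expectation (\<lambda>\<omega>. Z \<omega> (Suc n)) = 0" if "n \<ge> 1" for n
  proof -
    have "expectation (\<lambda>\<omega>. (e \<omega> n \<bullet> phihat (Suc n) \<omega>) * (if d (Suc n) \<omega> \<le> C - y (int (Suc n)) then 1 else 0))
        = expectation (\<lambda>\<omega>. e \<omega> n \<bullet> phihat (Suc n) \<omega>) * cdf (distr Pr borel (d (Suc n))) (C - y (int (Suc n)))"
      by (rule expectation_past_times_event[OF d_indep _ _ _ W_adapted W_bound[OF that]]) auto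
    then show ?thesis
      using W_int[OF that] Ws_int[OF that] d_distr[of "Suc n"]
      by (simp add: Bochner_Integration.integral_cong[OF refl Z_eq] del: of_nat_Suc)
  qed

  \<comment> \<open>Rate of the mean square error\<close>
  define r where "r k = expectation (\<lambda>\<omega>. (norm (e \<omega> k))\<^sup>2)" for k
  have sq_int: "integrable Pr (\<lambda>\<omega>. (norm (e \<omega> k))\<^sup>2)" if "k \<ge> 1" for k
  proof (rule integrable_const_bound[of _ "(2 * B)\<^sup>2"])
    show "AE \<omega> in Pr. norm ((norm (e \<omega> k))\<^sup>2) \<le> (2 * B)\<^sup>2"
    proof (rule AE_I2)
      fix \<omega> assume "\<omega> \<in> space Pr"
      from power_mono[OF e_bound[OF that this] norm_ge_zero, of 2]
      show "norm ((norm (e \<omega> k))\<^sup>2) \<le> (2 * B)\<^sup>2" by simp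
    qed
    show "(\<lambda>\<omega>. (norm (e \<omega> k))\<^sup>2) \<in> borel_measurable Pr"
      unfolding e_def using th_rv[of k] by simp
  qed
  have "r \<in> O(\<lambda>k. 1 / real k)"
  \<comment> \<open>One constant must serve the block and the single-step inequality. In the latter,
    the increment of |e|^2 is a difference of norms, at most \<open>\<gamma> * M\<^sub>2\<close> /
    (k + 1), times a sum of norms, at most 4 B.\<close>
  proof (rule block_recursion_rate[where \<alpha>="2 * \<gamma> * (f\<^sub>m * \<delta> - G)" and N=N and K="max K (4 * B * \<gamma> * M\<^sub>2)"])
    have gap': "f\<^sub>m * \<delta> - G > 0"
      using gap by (simp add: G_def g_def)
    have "\<gamma> > 1 / (2 * (f\<^sub>m * \<delta> - G))"
      using step by (simp add: G_def g_def)
    then show "2 * \<gamma> * (f\<^sub>m * \<delta> - G) > 1"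
      using gap' by (simp add: pos_divide_less_eq mult_ac)
    show "0 \<le> r k" for k
      by (simp add: r_def)
    show "r (k + N) \<le> (1 - 2 * \<gamma> * (f\<^sub>m * \<delta> - G) * real N / real (Suc k)) * r k
        + max K (4 * B * \<gamma> * M\<^sub>2) / (real (Suc k))\<^sup>2" if "k \<ge> 1" for k
    proof -
      have Zi: "integrable Pr (\<lambda>\<omega>. Z \<omega> i)" "expectation (\<lambda>\<omega>. Z \<omega> i) = 0" if "i \<in> {k<..k + N}" for i
        using that \<open>k \<ge> 1\<close> Z_int[of "i - 1"] Z_mean[of "i - 1"] by auto
      let ?c = "1 - 2 * \<gamma> * (f\<^sub>m * \<delta> - G) * real N / real (Suc k)"
      have "r (k + N) \<le> expectation (\<lambda>\<omega>. ?c * (norm (e \<omega> k))\<^sup>2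
          + (\<Sum>i\<in>{k<..k + N}. 2 * \<gamma> / real i * Z \<omega> i) + K / (real (Suc k))\<^sup>2)"
        unfolding r_def
      proof (rule integral_mono)
        show "integrable Pr (\<lambda>\<omega>. (norm (e \<omega> (k + N)))\<^sup>2)"
          using that by (intro sq_int) simp
        show "integrable Pr (\<lambda>\<omega>. ?c * (norm (e \<omega> k))\<^sup>2
            + (\<Sum>i\<in>{k<..k + N}. 2 * \<gamma> / real i * Z \<omega> i) + K / (real (Suc k))\<^sup>2)"
          using sq_int[OF that] Zi
          by (intro Bochner_Integration.integrable_add Bochner_Integration.integrable_sum
              integrable_mult_right integrable_const) auto
      qed (rule block[OF that])
      also have "\<dots> = ?c * r k + K / (real (Suc k))\<^sup>2"
      proof -
        have "integrable Pr (\<lambda>\<omega>. \<Sum>i\<in>{k<..k + N}. 2 * \<gamma> / real i * Z \<omega> i)"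
          using Zi by (intro Bochner_Integration.integrable_sum integrable_mult_right) auto
        moreover have "expectation (\<lambda>\<omega>. \<Sum>i\<in>{k<..k + N}. 2 * \<gamma> / real i * Z \<omega> i) = 0"
          using Zi by (subst Bochner_Integration.integral_sum) auto
        ultimately show ?thesis
          using sq_int[OF that]
          by (simp add: r_def prob_space del: of_nat_Suc times_divide_eq_left)
      qed
      also have "\<dots> \<le> ?c * r k + max K (4 * B * \<gamma> * M\<^sub>2) / (real (Suc k))\<^sup>2"
        by (intro add_left_mono divide_right_mono) auto
      finally show ?thesis .
    qed
    show "r (Suc k) \<le> r k + max K (4 * B * \<gamma> * M\<^sub>2) / real (Suc k)" if "k \<ge> 1" for k
    proof -
      have "r (Suc k) \<le> expectation (\<lambda>\<omega>. (norm (e \<omega> k))\<^sup>2 + 4 * B * \<gamma> * M\<^sub>2 / real (Suc k))"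
        unfolding r_def
      proof (rule integral_mono)
        fix \<omega> assume \<omega>: "\<omega> \<in> space Pr"
        have "(norm (e \<omega> (Suc k)))\<^sup>2 - (norm (e \<omega> k))\<^sup>2
            = (norm (e \<omega> (Suc k)) - norm (e \<omega> k)) * (norm (e \<omega> (Suc k)) + norm (e \<omega> k))"
          by (simp add: power2_eq_square algebra_simps)
        also have "\<dots> \<le> \<gamma> * M\<^sub>2 / real (Suc k) * (4 * B)"
        proof (rule mult_mono)
          show "norm (e \<omega> (Suc k)) - norm (e \<omega> k) \<le> \<gamma> * M\<^sub>2 / real (Suc k)"
            using e_step[OF that \<omega>] norm_triangle_ineq2 order.trans by blast
          show "norm (e \<omega> (Suc k)) + norm (e \<omega> k) \<le> 4 * B"
            using e_bound[OF that \<omega>] e_bound[of "Suc k" \<omega>] \<omega> by simp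
        qed (use gamma M2(1) in auto)
        finally show "(norm (e \<omega> (Suc k)))\<^sup>2 \<le> (norm (e \<omega> k))\<^sup>2 + 4 * B * \<gamma> * M\<^sub>2 / real (Suc k)"
          by (simp add: mult_ac del: of_nat_Suc)
      qed (use sq_int that in auto)
      also have "\<dots> = r k + 4 * B * \<gamma> * M\<^sub>2 / real (Suc k)"
        using sq_int[OF that] by (simp add: r_def prob_space del: of_nat_Suc)
      also have "\<dots> \<le> r k + max K (4 * B * \<gamma> * M\<^sub>2) / real (Suc k)"
        by (intro add_left_mono divide_right_mono) auto
      finally show ?thesis .
    qed
  qed (use N0 K(1) in auto)
  moreover have "r = (\<lambda>k. expectation (\<lambda>\<omega>. (thetahat k \<omega> - \<theta>) \<bullet> (thetahat k \<omega> - \<theta>)))"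
    by (simp add: fun_eq_iff r_def e_def power2_norm_eq_inner)
  ultimately show ?thesis by simp
qed

end
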